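(* For every integer $d\geq 2$ and every $\lambda\in\mathbb{R}$, the Julia set of $U_{d\lambda}$ is not a Sierpiński carpet.
   Context: For an integer $d\ge 2$ and $\lambda\in\mathbb{C}\setminus\{0\}$, $U_{d\lambda}$ is the rational map $$U_{d\lambda}(z)=\left(\frac{(z+\lambda-1)^d+(\lambda-1)(z-1)^d}{(z+\lambda-1)^d-(z-1)^d}\right)^d.$$ For $\lambda=0$, it degenerates to the polynomial $U_{d0}(z)=\left(\frac{z+d-1}{d}\right)^d$. Let $\overline{\mathbb{C}}=\mathbb{C}\cup\{\infty\}$ be the Riemann sphere. A connected and locally connected compact set $S\subset\overline{\mathbb{C}}$ is called a Sierpiński carpet if it has empty interior and can be written as $S=\overline{\mathbb{C}}\setminus\bigcup_{i\in\mathbb{N}}D_i$, where $\{D_i\}_{i\in\mathbb{N}}$ are Jordan regions satisfying $\partial D_i\cap\partial D_j=\emptyset$ for $i\ne j$ and the spherical diameter $\operatorname{diam}(\partial D_i)\to 0$ as $i\to\infty$. *)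

theory Defs
  imports
    "HOL-Analysis.Analysis"
    "HOL-Computational_Algebra.Polynomial"
begin

section \<open>The Riemann sphere with its spherical metric\<close>

datatype riemann_sphere = Fin complex | Infty

text \<open>
  Inverse stereographic projection onto the unit sphere of
  \<^typ>\<open>complex \<times> real\<close> (Euclidean 3-space), with projection centre \<open>(0, 1)\<close>.
\<close>

fun stereo :: "riemann_sphere \<Rightarrow> complex \<times> real" where
  "stereo (Fin z) = ((2 / ((cmod z)\<^sup>2 + 1)) *\<^sub>R z, ((cmod z)\<^sup>2 - 1) / ((cmod z)\<^sup>2 + 1))"
| "stereo Infty = (0, 1)"

lemma norm_stereo [simp]: "norm (stereo x) = 1"
proof (cases x)
  case (Fin z)
  define r where "r = (cmod z)\<^sup>2"
  have r: "r \<ge> 0" by (simp add: r_def)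
  have "(norm (stereo x))\<^sup>2 = (2 / (r + 1))\<^sup>2 * r + ((r - 1) / (r + 1))\<^sup>2"
    by (simp add: Fin norm_Pair r_def power_mult_distrib power_divide)
  also have "\<dots> = ((r + 1) / (r + 1))\<^sup>2"
    using r by (simp add: power_divide add_divide_distrib [symmetric])
      (simp add: power2_eq_square algebra_simps)
  also have "\<dots> = 1" using r by simp
  finally have "(norm (stereo x))\<^sup>2 = 1\<^sup>2" by simp
  then show ?thesis by (rule power2_eq_imp_eq) simp_all
qed simp

lemma stereo_inject [simp]: "stereo x = stereo y \<longleftrightarrow> x = y"
proof
  assume eq: "stereo x = stereo y"
  have lt: "snd (stereo (Fin z)) \<noteq> 1" for z
  proof -
    have "(cmod z)\<^sup>2 + 1 > 0" by (simp add: add_nonneg_pos)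
    then show ?thesis by (simp add: divide_eq_eq)
  qed
  show "x = y"
  proof (cases x)
    case x: (Fin z)
    show ?thesis
    proof (cases y)
      case y: (Fin w)
      define a b where "a = (cmod z)\<^sup>2" and "b = (cmod w)\<^sup>2"
      have ab: "a + 1 > 0" "b + 1 > 0" by (simp_all add: a_def b_def add_nonneg_pos)
      have "(a - 1) / (a + 1) = (b - 1) / (b + 1)"
        using eq by (simp add: x y a_def b_def)
      with ab have "a = b" by (simp add: frac_eq_eq algebra_simps)
      with eq ab show ?thesis by (simp add: x y a_def b_def)
    next
      case Infty
      with eq x lt[of z] show ?thesis by simp
    qed
  next
    case x: Infty
    show ?thesis
    proof (cases y)
      case (Fin w)
      with eq x lt[of w] show ?thesis by simp
    qed (simp add: x)
  qed
qed simp

lemma arccos_inner_triangle: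
  fixes a b c :: "'a::real_inner"
  assumes "norm a = 1" "norm b = 1" "norm c = 1"
  shows "arccos (a \<bullet> c) \<le> arccos (a \<bullet> b) + arccos (b \<bullet> c)"
proof -
  have bd: "\<bar>x \<bullet> y\<bar> \<le> 1" if "norm x = 1" "norm y = 1" for x y :: 'a
    using Cauchy_Schwarz_ineq2[of x y] that by simp
  note bds = bd[OF assms(1,2)] bd[OF assms(2,3)] bd[OF assms(1,3)]
  define s t where "s = a \<bullet> b" and "t = b \<bullet> c"
  have st: "-1 \<le> s" "s \<le> 1" "-1 \<le> t" "t \<le> 1" "-1 \<le> a \<bullet> c" "a \<bullet> c \<le> 1"
    using bds by (auto simp: s_def t_def abs_le_iff)
  have sq: "a \<bullet> a = 1" "b \<bullet> b = 1" "c \<bullet> c = 1"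
    using assms by (simp_all add: dot_square_norm)
  show ?thesis
  proof (cases "arccos s + arccos t \<le> pi")
    case True
    have na: "norm (a - s *\<^sub>R b) = sqrt (1 - s\<^sup>2)"
      unfolding norm_eq_sqrt_inner
      by (simp add: algebra_simps sq inner_commute[of b a] s_def[symmetric] power2_eq_square)
    have nc: "norm (c - t *\<^sub>R b) = sqrt (1 - t\<^sup>2)"
      unfolding norm_eq_sqrt_inner
      by (simp add: algebra_simps sq inner_commute[of c b] t_def[symmetric] power2_eq_square)
    have "(a - s *\<^sub>R b) \<bullet> (c - t *\<^sub>R b) = a \<bullet> c - s * t"
      by (simp add: algebra_simps sq t_def[symmetric] s_def[symmetric])
    moreover have "\<bar>(a - s *\<^sub>R b) \<bullet> (c - t *\<^sub>R b)\<bar> \<le> sqrt (1 - s\<^sup>2) * sqrt (1 - t\<^sup>2)"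
      using Cauchy_Schwarz_ineq2[of "a - s *\<^sub>R b" "c - t *\<^sub>R b"] by (simp add: na nc)
    ultimately have "s * t - sqrt (1 - s\<^sup>2) * sqrt (1 - t\<^sup>2) \<le> a \<bullet> c" by linarith
    moreover have "cos (arccos s + arccos t) = s * t - sqrt (1 - s\<^sup>2) * sqrt (1 - t\<^sup>2)"
      using st by (simp add: cos_add sin_arccos)
    ultimately have "cos (arccos s + arccos t) \<le> cos (arccos (a \<bullet> c))"
      using st by simp
    then show ?thesis
      using True st
      by (subst (asm) cos_mono_le_eq)
        (auto simp: arccos_lbound arccos_ubound s_def t_def intro!: add_nonneg_nonneg)
  next
    case False
    then show ?thesis using arccos_ubound[of "a \<bullet> c"] st by (simp add: s_def t_def)
  qed
qed

instantiation riemann_sphere :: metric_space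
begin

text \<open>Great-circle distance on the unit sphere.\<close>

definition dist_riemann_sphere :: "riemann_sphere \<Rightarrow> riemann_sphere \<Rightarrow> real" where
  "dist_riemann_sphere x y = arccos (stereo x \<bullet> stereo y)"

definition uniformity_riemann_sphere :: "(riemann_sphere \<times> riemann_sphere) filter" where
  "uniformity_riemann_sphere = (INF e\<in>{0<..}. principal {(x, y). dist x y < e})"

definition open_riemann_sphere :: "riemann_sphere set \<Rightarrow> bool" where
  "open_riemann_sphere U \<longleftrightarrow> (\<forall>x\<in>U. \<forall>\<^sub>F (x', y) in uniformity. x' = x \<longrightarrow> y \<in> U)"

instance
proof
  fix x y z :: riemann_sphere
  have le: "\<bar>stereo x \<bullet> stereo y\<bar> \<le> 1"
    using Cauchy_Schwarz_ineq2[of "stereo x" "stereo y"] by simp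
  have "arccos (stereo x \<bullet> stereo y) = 0 \<longleftrightarrow> stereo x \<bullet> stereo y = 1"
    using cos_arccos_abs[OF le] by (auto dest: arg_cong[where f = cos])
  also have "\<dots> \<longleftrightarrow> x = y"
  proof
    assume "stereo x \<bullet> stereo y = 1"
    then have "(norm (stereo x - stereo y))\<^sup>2 = 0"
      using dot_square_norm[of "stereo x"] dot_square_norm[of "stereo y"]
      unfolding power2_norm_eq_inner inner_diff_left inner_diff_right
        inner_commute[of "stereo y" "stereo x"] norm_stereo by simp
    then show "x = y" by simp
  qed (simp add: dot_square_norm)
  finally show "dist x y = 0 \<longleftrightarrow> x = y" by (simp add: dist_riemann_sphere_def)
  show "dist x y \<le> dist x z + dist y z"
    using arccos_inner_triangle[of "stereo x" "stereo z" "stereo y"]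
    by (simp add: dist_riemann_sphere_def inner_commute[of "stereo z" "stereo y"])
qed (rule uniformity_riemann_sphere_def open_riemann_sphere_def)+

end


section \<open>Julia sets\<close>

text \<open>
  The limit is only required to exist as a function into the sphere; for families of continuous
  (holomorphic) maps it is then automatically continuous (holomorphic) on the open set \<open>W\<close>.
\<close>

definition normal_family_on ::
  "'a::topological_space set \<Rightarrow> ('a \<Rightarrow> 'b::metric_space) set \<Rightarrow> bool" where
  "normal_family_on W F \<longleftrightarrow>
    (\<forall>f::nat \<Rightarrow> 'a \<Rightarrow> 'b. range f \<subseteq> F \<longrightarrow>
      (\<exists>r g. strict_mono (r::nat \<Rightarrow> nat) \<and>
        (\<forall>K. compact K \<and> K \<subseteq> W \<longrightarrow> uniform_limit K (\<lambda>n. f (r n)) g sequentially)))"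

definition fatou_set :: "(riemann_sphere \<Rightarrow> riemann_sphere) \<Rightarrow> riemann_sphere set" where
  "fatou_set f = {z. \<exists>W. open W \<and> z \<in> W \<and> normal_family_on W (range (\<lambda>n. f ^^ n))}"

definition julia_set :: "(riemann_sphere \<Rightarrow> riemann_sphere) \<Rightarrow> riemann_sphere set" where
  "julia_set f = - fatou_set f"


section \<open>Sierpinski carpets\<close>

definition jordan_region :: "riemann_sphere set \<Rightarrow> bool" where
  "jordan_region D \<longleftrightarrow>
    (\<exists>\<gamma>. simple_path \<gamma> \<and> pathfinish \<gamma> = pathstart \<gamma> \<and> D \<in> components (- path_image \<gamma>))"

definition sierpinski_carpet :: "riemann_sphere set \<Rightarrow> bool" where
  "sierpinski_carpet S \<longleftrightarrow>
    connected S \<and> locally connected S \<and> compact S \<and> interior S = {} \<and>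
    (\<exists>D :: nat \<Rightarrow> riemann_sphere set.
      S = UNIV - (\<Union>i. D i) \<and>
      (\<forall>i. jordan_region (D i)) \<and>
      (\<forall>i j. i \<noteq> j \<longrightarrow> frontier (D i) \<inter> frontier (D j) = {}) \<and>
      (\<lambda>i. diameter (frontier (D i))) \<longlonglongrightarrow> 0)"


section \<open>The rational maps\<close>

text \<open>
  The self-map of the sphere given by \<open>p / q\<close>, where \<open>p\<close> and \<open>q\<close> have no common root. At infinity it takes the limit value, read off from the coefficients in degree
  \<open>max (degree p) (degree q)\<close>.
\<close>

fun rational_map :: "complex poly \<Rightarrow> complex poly \<Rightarrow> riemann_sphere \<Rightarrow> riemann_sphere" where
  "rational_map p q (Fin z) = (if poly q z = 0 then Infty else Fin (poly p z / poly q z))"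
| "rational_map p q Infty =
    (let n = max (degree p) (degree q)
     in if coeff q n = 0 then Infty else Fin (coeff p n / coeff q n))"

definition U_num :: "nat \<Rightarrow> complex \<Rightarrow> complex poly" where
  "U_num d l = ([:l - 1, 1:] ^ d + smult (l - 1) ([:-1, 1:] ^ d)) ^ d"

definition U_den :: "nat \<Rightarrow> complex \<Rightarrow> complex poly" where
  "U_den d l = ([:l - 1, 1:] ^ d - [:-1, 1:] ^ d) ^ d"

definition U :: "nat \<Rightarrow> complex \<Rightarrow> riemann_sphere \<Rightarrow> riemann_sphere" where
  "U d l =
    (if l = 0 then rational_map ([:(of_nat d - 1) / of_nat d, 1 / of_nat d:] ^ d) 1
     else rational_map (U_num d l) (U_den d l))"

lemma U_Fin:
  assumes "l \<noteq> 0"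
  shows "U d l (Fin z) =
    (if (z + l - 1) ^ d - (z - 1) ^ d = 0 \<and> d \<noteq> 0 then Infty
     else Fin ((((z + l - 1) ^ d + (l - 1) * (z - 1) ^ d) / ((z + l - 1) ^ d - (z - 1) ^ d)) ^ d))"
proof -
  have "poly [:l - 1, 1:] z = z + l - 1" "poly [:-1, 1:] z = z - 1" by simp_all
  then show ?thesis
    using assms
    by (simp add: U_def U_num_def U_den_def power_divide
        del: poly_pCons right_minus_eq)
qed

lemma U_0_Fin: "d > 0 \<Longrightarrow> U d 0 (Fin z) = Fin (((z + of_nat d - 1) / of_nat d) ^ d)"
  by (simp add: U_def add_divide_distrib diff_divide_distrib add.commute add_diff_eq)

lemma U_no_common_root:
  assumes "l \<noteq> 0" "poly (U_num d l) z = 0"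
  shows "poly (U_den d l) z \<noteq> 0"
proof
  define a b where "a = (z + l - 1) ^ d" and "b = (z - 1) ^ d"
  assume "poly (U_den d l) z = 0"
  then have d: "d > 0" and "a - b = 0"
    by (auto simp: U_den_def a_def b_def algebra_simps intro: gr0I)
  moreover from assms have "a + (l - 1) * b = 0"
    by (auto simp: U_num_def a_def b_def algebra_simps)
  ultimately have "l * b = 0" "a = b" by (simp_all add: algebra_simps)
  with assms have "b = 0" "a = 0" by auto
  then have "z - 1 = 0" "z + l - 1 = 0" unfolding a_def b_def by (blast dest: power_eq_0_iff[THEN iffD1])+
  then have "(z + l - 1) - (z - 1) = 0" by simp
  with assms show False by simp
qed

lemma U_Infty:
  assumes "d > 0"
  shows "U d l Infty = Infty"
proof (cases "l = 0")
  case True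
  have "degree [:(of_nat d - 1) / of_nat d, 1 / of_nat d :: complex:] = 1" using assms by simp
  moreover from this have "[:(of_nat d - 1) / of_nat d, 1 / of_nat d :: complex:] \<noteq> 0"
    by (metis degree_0 zero_neq_one)
  ultimately have "degree ([:(of_nat d - 1) / of_nat d, 1 / of_nat d :: complex:] ^ d) = d"
    by (simp only: degree_power_eq mult_1_right not_False_eq_True)
  with True assms show ?thesis by (simp add: U_def Let_def)
next
  case False
  define A B where "A = [:l - 1, 1:]" and "B = [:-1, 1::complex:]"
  define P Q where "P = A ^ d + smult (l - 1) (B ^ d)" and "Q = A ^ d - B ^ d"
  have deg: "degree (A ^ d) = d" "degree (B ^ d) = d"
    by (simp_all add: A_def B_def degree_power_eq)
  have lc: "coeff (A ^ d) d = 1" "coeff (B ^ d) d = 1"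
    using lead_coeff_power[of A d] lead_coeff_power[of B d] unfolding deg
    by (simp_all add: A_def B_def)
  have "coeff P d = l" by (simp add: P_def lc)
  moreover have "degree P \<le> d"
    unfolding P_def by (intro degree_add_le order.trans[OF degree_smult_le]) (simp_all add: deg)
  ultimately have P: "degree P = d" using False le_degree[of P d] by simp
  then have P': "degree (P ^ d) = d * d" using assms by (cases "P = 0") (auto simp: degree_power_eq)
  have "degree Q \<le> d" unfolding Q_def by (intro degree_diff_le) (simp_all add: deg)
  moreover have "coeff Q d = 0" by (simp add: Q_def lc)
  ultimately have "degree Q < d"
    using assms by (metis degree_0 leading_coeff_0_iff nat_less_le)
  then have "degree (Q ^ d) < d * d"
    using degree_power_le[of Q d] assms by (meson le_less_trans mult_less_mono1)
  with P' have "max (degree (P ^ d)) (degree (Q ^ d)) = d * d" "coeff (Q ^ d) (d * d) = 0"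
    by (simp_all add: coeff_eq_0)
  with False show ?thesis
    by (simp add: U_def U_num_def U_den_def A_def B_def P_def Q_def)
qed

end

theory Submission
  imports Defs
begin

text \<open>
  A point of the Julia set that is a common frontier point of two different Fatou components rules out
  a carpet, because the complementary regions of a carpet have disjoint frontiers. For real \<open>l\<close> such a
  point lies on the real axis.

  For \<open>l \<noteq> 0\<close> the map is \<open>T \<circ> T\<close> with \<open>T z = (1 + l / (z - 1))\<^sup>d\<close>, and \<open>T\<close> exchanges the superattracting
  fixed points \<open>1\<close> and \<open>\<infinity>\<close> of \<open>T \<circ> T\<close>. Let \<open>A\<close> be the basin of \<open>\<infinity>\<close>; then \<open>T\<^sup>-\<^sup>1 A\<close> is the basin of
  \<open>1\<close>. There is a real fixed point \<open>x\<close> of \<open>T \<circ> T\<close> with real intervals of \<open>A\<close> and of \<open>T\<^sup>-\<^sup>1 A\<close> ending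
  at \<open>x\<close> from its two sides. In the coordinate \<open>w = z - 1\<close> let \<open>\<tau> w = (1 + l / w)\<^sup>d - 1\<close>. The identity
  \<open>w \<cdot> \<tau> w = l \<cdot> \<Sum>k<d. (1 + l / w)\<^sup>k\<close> turns the comparison of \<open>\<tau> (\<tau> w)\<close> with \<open>w\<close> into a comparison of
  two geometric sums, which is a question of monotonicity. For \<open>l > 0\<close>, and for \<open>l < 0\<close> with \<open>d\<close> even, \<open>x\<close> is
  a repelling fixed point of \<open>T\<close> on the right of \<open>1\<close>
  (\<open>not_sierpinski_carpet_positive\<close>, \<open>not_sierpinski_carpet_negative_even\<close>); for \<open>l < 0\<close> with \<open>d\<close> odd
  it belongs to a cycle of period two and is taken on the left of \<open>1\<close>
  (\<open>not_sierpinski_carpet_negative_odd\<close>). For \<open>l = 0\<close> the point is the parabolic fixed point \<open>1\<close>: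
  the interval \<open>(1, \<infinity>)\<close> escapes, while the iterates tend to \<open>1\<close> on the unit disc
  (\<open>not_sierpinski_carpet_zero\<close>).

  Two general facts make this enough. First, the frontier of \<open>A\<close> lies in the Julia set
  (\<open>closure_basin_Int_fatou_set\<close>), so each complementary region of the Julia set lies in \<open>A\<close> or avoids
  it, and only continuity of the map is needed to see this. Second, if the Julia set is a carpet, an
  interval of the Fatou set that ends at a Julia point \<open>x\<close> singles out one region with \<open>x\<close> on its
  frontier (\<open>segment_ends_at_region\<close>). The definition of a carpet does not make the regions disjoint, so they
  might be nested; the Jordan curve theorem makes their frontiers connected, which leaves nested
  chains as the only overlaps, and the shrinking diameters of the frontiers bound those chains.
\<close>

section \<open>The topology of the sphere\<close>

lemma inner_stereo: "stereo x \<bullet> stereo y = cos (dist x y)"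
proof -
  have "\<bar>stereo x \<bullet> stereo y\<bar> \<le> 1"
    using Cauchy_Schwarz_ineq2[of "stereo x" "stereo y"] by simp
  then show ?thesis by (simp add: dist_riemann_sphere_def cos_arccos_abs)
qed

lemma dist_stereo_square: "(dist (stereo x) (stereo y))\<^sup>2 = 2 - 2 * cos (dist x y)"
  using dot_norm_neg[of "stereo x" "stereo y"]
  unfolding dist_norm[symmetric] inner_stereo norm_stereo by simp

lemma tendsto_stereo_iff: "((\<lambda>t. stereo (f t)) \<longlongrightarrow> stereo x) F \<longleftrightarrow> (f \<longlongrightarrow> x) F"
proof
  assume "(f \<longlongrightarrow> x) F"
  then have "((\<lambda>t. dist (f t) x) \<longlongrightarrow> 0) F" by (simp only: tendsto_dist_iff[of f])
  then have "((\<lambda>t. sqrt (2 - 2 * cos (dist (f t) x))) \<longlongrightarrow> sqrt (2 - 2 * cos 0)) F"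
    by (intro tendsto_intros isCont_tendsto_compose[OF isCont_cos])
  then have "((\<lambda>t. dist (stereo (f t)) (stereo x)) \<longlongrightarrow> 0) F"
    by (simp add: dist_stereo_square [symmetric])
  then show "((\<lambda>t. stereo (f t)) \<longlongrightarrow> stereo x) F" by (simp add: tendsto_dist_iff[of "\<lambda>t. stereo (f t)"])
next
  assume "((\<lambda>t. stereo (f t)) \<longlongrightarrow> stereo x) F"
  then have "((\<lambda>t. stereo (f t) \<bullet> stereo x) \<longlongrightarrow> stereo x \<bullet> stereo x) F"
    by (intro tendsto_intros)
  then have *: "((\<lambda>t. stereo (f t) \<bullet> stereo x) \<longlongrightarrow> 1) F" by (simp add: dot_square_norm)
  have "((\<lambda>t. arccos (stereo (f t) \<bullet> stereo x)) \<longlongrightarrow> arccos 1) F"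
    by (rule continuous_on_tendsto_compose[OF continuous_on_arccos' *])
      (auto simp: inner_stereo)
  then show "(f \<longlongrightarrow> x) F" by (subst tendsto_dist_iff) (simp add: dist_riemann_sphere_def)
qed

lemma isCont_iff_nhds: "isCont f x \<longleftrightarrow> (f \<longlongrightarrow> f x) (nhds x)"
  unfolding isCont_def by (rule tendsto_at_iff_tendsto_nhds)

lemma isCont_stereo [continuous_intros]: "isCont stereo x"
  unfolding isCont_def tendsto_stereo_iff by (rule tendsto_ident_at)

lemma snd_stereo_Fin: "snd (stereo (Fin z)) = 1 - 2 / ((cmod z)\<^sup>2 + 1)"
proof -
  have "(cmod z)\<^sup>2 + 1 > 0" by (simp add: add_nonneg_pos)
  then show ?thesis by (simp add: field_simps)
qed

lemma isCont_Fin: "isCont Fin a"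
proof -
  have "(cmod z)\<^sup>2 + 1 \<noteq> 0" for z by (metis add_nonneg_pos less_irrefl zero_le_power2 zero_less_one)
  then show ?thesis
  unfolding isCont_def tendsto_stereo_iff[symmetric] stereo.simps
    by (intro tendsto_intros) auto
qed

text \<open>Stereographic projection. At \<^const>\<open>Infty\<close>, where it takes a default value, it is not continuous.\<close>

definition coord :: "riemann_sphere \<Rightarrow> complex" where
  "coord x = fst (stereo x) /\<^sub>R (1 - snd (stereo x))"

lemma coord_Fin [simp]: "coord (Fin z) = z"
proof -
  have "(cmod z)\<^sup>2 + 1 \<noteq> 0" by (metis add_nonneg_pos less_irrefl zero_le_power2 zero_less_one)
  then show ?thesis unfolding coord_def snd_stereo_Fin by (simp add: field_simps)
qed

lemma snd_stereo_neq_1: "x \<noteq> Infty \<Longrightarrow> snd (stereo x) \<noteq> 1"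
proof (cases x)
  case (Fin z)
  have "(cmod z)\<^sup>2 + 1 \<noteq> 0" by (metis add_nonneg_pos less_irrefl zero_le_power2 zero_less_one)
  then show ?thesis unfolding Fin snd_stereo_Fin by simp
qed simp

lemma isCont_coord: "x \<noteq> Infty \<Longrightarrow> isCont coord x"
  unfolding coord_def[abs_def] using snd_stereo_neq_1[of x]
  by (intro continuous_intros) auto

text \<open>
  Together with the next lemma this describes the spherical topology as the one-point
  compactification of the plane; continuity on the sphere is checked in this form.
\<close>

lemma eventually_nhds_Fin:
  "eventually P (nhds (Fin a)) \<longleftrightarrow> eventually (\<lambda>z. P (Fin z)) (nhds a)"
proof
  assume "eventually P (nhds (Fin a))"
  then show "eventually (\<lambda>z. P (Fin z)) (nhds a)"
    by (rule eventually_compose_filterlim)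
      (use isCont_Fin[of a] in \<open>simp only: isCont_iff_nhds\<close>)
next
  assume P: "eventually (\<lambda>z. P (Fin z)) (nhds a)"
  have "(coord \<longlongrightarrow> a) (nhds (Fin a))"
    using isCont_coord[of "Fin a"] by (simp add: isCont_iff_nhds)
  with P have 1: "eventually (\<lambda>x. P (Fin (coord x))) (nhds (Fin a))"
    by (rule eventually_compose_filterlim)
  have 2: "eventually (\<lambda>x. x \<noteq> Infty) (nhds (Fin a))"
    by (rule t1_space_nhds) simp
  show "eventually P (nhds (Fin a))"
    using 1 2 by eventually_elim (metis coord_Fin riemann_sphere.exhaust)
qed

lemma eventually_nhds_Infty:
  "eventually P (nhds Infty) \<longleftrightarrow> P Infty \<and> (\<exists>R. \<forall>z. R \<le> cmod z \<longrightarrow> P (Fin z))"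
proof (intro iffI conjI)
  assume P: "eventually P (nhds Infty)"
  then show "P Infty" by (rule eventually_nhds_x_imp_x)
  have "filterlim (\<lambda>z::complex. (cmod z)\<^sup>2 + 1) at_top at_infinity"
    unfolding add.commute[of _ "1::real"]
    by (intro filterlim_tendsto_add_at_top[OF tendsto_const] filterlim_pow_at_top filterlim_norm_at_top)
      simp
  then have "((\<lambda>z::complex. 1 - 2 / ((cmod z)\<^sup>2 + 1)) \<longlongrightarrow> 1 - 0) at_infinity"
    by (intro tendsto_diff tendsto_const tendsto_divide_0[OF tendsto_const] filterlim_at_top_imp_at_infinity)
  then have "((\<lambda>z. arccos (1 - 2 / ((cmod z)\<^sup>2 + 1))) \<longlongrightarrow> arccos 1) at_infinity"
    by (intro continuous_on_tendsto_compose[OF continuous_on_arccos'])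
      (auto intro!: always_eventually simp: divide_le_eq add_nonneg_pos)
  then have "(Fin \<longlongrightarrow> Infty) at_infinity"
    by (subst tendsto_dist_iff)
      (simp add: dist_riemann_sphere_def snd_stereo_Fin inner_prod_def del: stereo.simps(1)
        add: stereo.simps(2))
  with P have "eventually (\<lambda>z. P (Fin z)) at_infinity"
    by (rule eventually_compose_filterlim)
  then show "\<exists>R. \<forall>z. R \<le> cmod z \<longrightarrow> P (Fin z)"
    by (simp add: eventually_at_infinity)
next
  assume "P Infty \<and> (\<exists>R. \<forall>z. R \<le> cmod z \<longrightarrow> P (Fin z))"
  then obtain R where P: "P Infty" "\<And>z. R \<le> cmod z \<Longrightarrow> P (Fin z)" by blast
  have "isCont (\<lambda>x. snd (stereo x)) Infty" by (intro continuous_intros)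
  then have "((\<lambda>x. snd (stereo x)) \<longlongrightarrow> 1) (nhds Infty)"
    by (simp add: isCont_iff_nhds)
  then have "eventually (\<lambda>x. snd (stereo x) > 1 - 2 / (R\<^sup>2 + 1)) (nhds Infty)"
    by (rule order_tendstoD) (simp add: add_nonneg_pos)
  then show "eventually P (nhds Infty)"
  proof eventually_elim
    case (elim x)
    show ?case
    proof (cases x)
      case (Fin z)
      have "2 / ((cmod z)\<^sup>2 + 1) < 2 / (R\<^sup>2 + 1)" using elim unfolding Fin snd_stereo_Fin by simp
      then have "R\<^sup>2 + 1 < (cmod z)\<^sup>2 + 1"
        by (smt (verit) frac_less2 zero_le_power2)
      then have "R\<^sup>2 < (cmod z)\<^sup>2" by simp
      then have "R \<le> cmod z" using power2_less_imp_less[of R "cmod z"] by simp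
      then show ?thesis using P Fin by simp
    qed (simp add: P)
  qed
qed
lemma isCont_eventuallyI:
  "(\<And>P. eventually P (nhds (f x)) \<Longrightarrow> eventually (\<lambda>y. P (f y)) (nhds x)) \<Longrightarrow> isCont f x"
  by (simp add: isCont_iff_nhds filterlim_iff)

lemma isCont_FinI: "isCont (\<lambda>z. f (Fin z)) a \<Longrightarrow> isCont f (Fin a)"
  by (rule isCont_eventuallyI)
    (simp add: eventually_nhds_Fin isCont_iff_nhds filterlim_iff)

lemma isCont_InftyI:
  assumes "((\<lambda>z. f (Fin z)) \<longlongrightarrow> f Infty) at_infinity"
  shows "isCont f Infty"
proof (rule isCont_eventuallyI)
  fix P assume P: "eventually P (nhds (f Infty))"
  then have "eventually (\<lambda>z. P (f (Fin z))) at_infinity"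
    using assms by (simp add: filterlim_iff)
  then show "eventually (\<lambda>y. P (f y)) (nhds Infty)"
    using eventually_nhds_x_imp_x[OF P] by (simp add: eventually_nhds_Infty eventually_at_infinity)
qed

lemma tendsto_Infty:
  assumes "filterlim g at_infinity F"
  shows "((\<lambda>t. Fin (g t)) \<longlongrightarrow> Infty) F"
  unfolding filterlim_iff
proof safe
  fix P assume "eventually P (nhds Infty)"
  then have "eventually (\<lambda>z. P (Fin z)) at_infinity"
    by (simp add: eventually_nhds_Infty eventually_at_infinity)
  then show "eventually (\<lambda>t. P (Fin (g t))) F"
    by (rule eventually_compose_filterlim) fact
qed

lemma tendsto_Fin: "(g \<longlongrightarrow> a) F \<Longrightarrow> ((\<lambda>t. Fin (g t)) \<longlongrightarrow> Fin a) F"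
  by (rule isCont_tendsto_compose[OF isCont_Fin])

lemma filterlim_affine_at_infinity:
  fixes a b :: complex
  assumes "b \<noteq> 0"
  shows "filterlim (\<lambda>z. a + b * z) at_infinity at_infinity"
  by (intro tendsto_add_filterlim_at_infinity[OF tendsto_const]
      tendsto_mult_filterlim_at_infinity[OF tendsto_const] filterlim_ident assms)

text \<open>An involution that exchanges \<open>a\<close> and \<open>\<infinity>\<close>; it moves any point of the sphere to \<open>\<infinity>\<close>.\<close>

fun invert_at :: "complex \<Rightarrow> riemann_sphere \<Rightarrow> riemann_sphere" where
  "invert_at a Infty = Fin a"
| "invert_at a (Fin z) = (if z = a then Infty else Fin (a + 1 / (z - a)))"

lemma invert_at_invert_at [simp]: "invert_at a (invert_at a x) = x"
  by (cases x) auto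

lemma isCont_invert_at: "isCont (invert_at a) x"
proof (cases x)
  case (Fin z)
  show ?thesis unfolding Fin
  proof (rule isCont_FinI, cases "z = a")
    case True
    have "filterlim (\<lambda>z. a + 1 / (z - a)) at_infinity (at a)"
      unfolding divide_inverse mult_1
      by (intro tendsto_add_filterlim_at_infinity[OF tendsto_const]
          filterlim_compose[OF filterlim_inverse_at_infinity])
        (auto simp: filterlim_at intro!: tendsto_eq_intros simp: eventually_at_filter)
    from tendsto_Infty[OF this] have "((\<lambda>z. invert_at a (Fin z)) \<longlongrightarrow> Infty) (at a)"
      by (rule Lim_transform_eventually) (auto simp: eventually_at_filter)
    then show "isCont (\<lambda>z. invert_at a (Fin z)) z" by (simp add: isCont_def True)
  next
    case False
    have "isCont (\<lambda>z. Fin (a + 1 / (z - a))) z"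
      using False by (intro isCont_o2[OF _ isCont_Fin] continuous_intros) auto
    moreover have "eventually (\<lambda>z. z \<noteq> a) (nhds z)" by (rule t1_space_nhds[OF False])
    then have "eventually (\<lambda>z. invert_at a (Fin z) = Fin (a + 1 / (z - a))) (nhds z)"
      by eventually_elim simp
    ultimately show "isCont (\<lambda>z. invert_at a (Fin z)) z"
      by (simp add: isCont_cong)
  qed
next
  case Infty
  have "((\<lambda>z. a + 1 / (z - a)) \<longlongrightarrow> a + 0) at_infinity"
    using filterlim_affine_at_infinity[of 1 "-a"]
    by (intro tendsto_add tendsto_const tendsto_divide_0[OF tendsto_const]) simp
  then have "((\<lambda>z. Fin (a + 1 / (z - a))) \<longlongrightarrow> Fin a) at_infinity"
    using tendsto_Fin by fastforce
  moreover have "eventually (\<lambda>z. Fin (a + 1 / (z - a)) = invert_at a (Fin z)) at_infinity"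
    unfolding eventually_at_infinity by (rule exI[of _ "cmod a + 1"]) auto
  ultimately show ?thesis unfolding Infty
    by (intro isCont_InftyI) (simp add: Lim_transform_eventually)
qed

text \<open>
  The polynomial map \<^const>\<open>U\<close> for the parameter \<open>0\<close> is of this form; for other parameters \<^const>\<open>U\<close> is
  composed of two such maps and two copies of \<^term>\<open>invert_at 1\<close>.
\<close>

fun affine_power :: "nat \<Rightarrow> complex \<Rightarrow> riemann_sphere \<Rightarrow> riemann_sphere" where
  "affine_power d c Infty = Infty"
| "affine_power d c (Fin z) = Fin ((1 + c * (z - 1)) ^ d)"

lemma isCont_affine_power:
  assumes "c \<noteq> 0" "d > 0"
  shows "isCont (affine_power d c) x"
proof (cases x)
  case (Fin z)
  show ?thesis unfolding Fin
    by (rule isCont_FinI) (simp, intro isCont_o2[OF _ isCont_Fin] continuous_intros)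
next
  case Infty
  have "filterlim (\<lambda>z. (1 - c) + c * z) at_infinity at_infinity"
    by (rule filterlim_affine_at_infinity) fact
  then have "filterlim (\<lambda>z. 1 + c * (z - 1)) at_infinity at_infinity"
    by (simp add: algebra_simps)
  then have "filterlim (\<lambda>z. (1 + c * (z - 1)) ^ d) at_infinity at_infinity"
    using assms by (intro Limits.filterlim_power_at_infinity) auto
  then show ?thesis unfolding Infty by (intro isCont_InftyI) (simp add: tendsto_Infty)
qed

section \<open>Jordan regions\<close>

lemma open_iff_eventually: "open W \<longleftrightarrow> (\<forall>x\<in>W. eventually (\<lambda>y. y \<in> W) (nhds x))"
  by (metis eventually_nhds open_subopen subsetI subset_eq)

lemma continuous_on_Fin: "continuous_on S Fin"
  by (simp add: continuous_at_imp_continuous_on isCont_Fin)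

lemma continuous_on_invert_at: "continuous_on S (invert_at a)"
  by (simp add: continuous_at_imp_continuous_on isCont_invert_at)

lemma open_Fin_image:
  assumes "open S"
  shows "open (Fin ` S)"
  unfolding open_iff_eventually
proof safe
  fix a assume "a \<in> S"
  with assms have "eventually (\<lambda>z. z \<in> S) (nhds a)" by (rule eventually_nhds_in_open)
  then show "eventually (\<lambda>y. y \<in> Fin ` S) (nhds (Fin a))"
    unfolding eventually_nhds_Fin by (rule eventually_mono) blast
qed

lemma exists_connected_open_neighbourhood:
  fixes x :: riemann_sphere
  assumes "open W" "x \<in> W"
  shows "\<exists>V. open V \<and> connected V \<and> x \<in> V \<and> V \<subseteq> W"
proof -
  have fin: "\<exists>V. open V \<and> connected V \<and> Fin a \<in> V \<and> V \<subseteq> W" if "open W" "Fin a \<in> W" for a W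
  proof -
    have "open (Fin -` W)" by (intro open_vimage that(1) continuous_on_Fin)
    moreover have "a \<in> Fin -` W" using that(2) by simp
    ultimately obtain e where e: "e > 0" "ball a e \<subseteq> Fin -` W" by (rule openE)
    have "open (Fin ` ball a e)" "connected (Fin ` ball a e)"
      by (intro open_Fin_image open_ball connected_continuous_image continuous_on_Fin connected_ball)+
    moreover have "Fin a \<in> Fin ` ball a e" "Fin ` ball a e \<subseteq> W" using e by auto
    ultimately show ?thesis by blast
  qed
  show ?thesis
  proof (cases x)
    case (Fin a)
    with fin[of W a] assms show ?thesis by simp
  next
    case Infty
    have op: "open (invert_at 0 -` V)" if "open V" for V
      using that by (intro open_vimage continuous_on_invert_at)
    from fin[of "invert_at 0 -` W" 0] op[of W] assms Infty
    obtain V where V: "open V" "connected V" "Fin 0 \<in> V" "V \<subseteq> invert_at 0 -` W" by auto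
    have "invert_at 0 ` V = invert_at 0 -` V" by (force intro: image_eqI)
    then have "open (invert_at 0 ` V)" using op V by simp
    moreover have "connected (invert_at 0 ` V)"
      by (intro connected_continuous_image continuous_on_invert_at V)
    moreover have "Infty \<in> invert_at 0 ` V" using V(3) by (rule image_eqI[rotated]) simp
    moreover have "invert_at 0 ` V \<subseteq> W" using V(4) by blast
    ultimately show ?thesis using Infty by blast
  qed
qed

lemma open_component:
  assumes "open (W :: riemann_sphere set)" "D \<in> components W"
  shows "open D"
proof (subst open_subopen, intro ballI)
  fix x assume x: "x \<in> D"
  with assms have "x \<in> W" using in_components_subset by blast
  with assms obtain V where V: "open V" "connected V" "x \<in> V" "V \<subseteq> W"
    using exists_connected_open_neighbourhood by meson
  then have "V \<subseteq> D" using components_maximal[OF assms(2) V(2,4)] x by blast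
  with V show "\<exists>T. open T \<and> x \<in> T \<and> T \<subseteq> D" by blast
qed

lemma connected_UNIV_sphere: "connected (UNIV :: riemann_sphere set)"
proof -
  have "T \<inter> range Fin \<noteq> {}" if "open T" "Infty \<in> T" for T
  proof -
    have "eventually (\<lambda>x. x \<in> T) (nhds Infty)" using that by (rule eventually_nhds_in_open)
    then obtain R where "\<And>z. R \<le> cmod z \<Longrightarrow> Fin z \<in> T" unfolding eventually_nhds_Infty by blast
    then have "Fin (of_real \<bar>R\<bar>) \<in> T" by simp
    then show ?thesis by blast
  qed
  from this[of "- closure (range Fin)"] have "Infty \<in> closure (range Fin)"
    using closure_subset[of "range Fin"] by auto
  then have "x \<in> closure (range Fin)" for x
    using closure_subset[of "range Fin"] by (cases x) auto
  then have "closure (range Fin) = UNIV" by blast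
  moreover have "connected (closure (range Fin))"
    by (intro connected_imp_connected_closure connected_continuous_image connected_UNIV continuous_on_Fin)
  ultimately show ?thesis by simp
qed

lemma not_open_singleton: "\<not> open {x :: riemann_sphere}"
proof
  assume "open {x}"
  then have "{x} = UNIV"
    using connected_UNIV_sphere unfolding connected_clopen by auto
  then have "Infty = x" "Fin 0 = x" by blast+
  then show False by simp
qed

text \<open>
  The frontier of a Jordan region is its whole bounding curve: seen from a point of the region, the
  remainder of the sphere is a plane, in which the Jordan curve theorem says that the curve bounds
  both sides, and the region contains one of them.
\<close>

lemma frontier_Jordan_region:
  fixes \<gamma> :: "real \<Rightarrow> riemann_sphere"
  assumes "simple_path \<gamma>" "pathfinish \<gamma> = pathstart \<gamma>" "D \<in> components (- path_image \<gamma>)"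
  shows "open D" "frontier D = path_image \<gamma>"
proof -
  have clo: "closed (path_image \<gamma>)"
    by (intro compact_imp_closed compact_path_image simple_path_imp_path assms(1))
  then show "open D" using assms(3) open_component open_Compl by blast
  have D: "D \<subseteq> - path_image \<gamma>" using assms(3) in_components_subset by blast
  \<comment> \<open>\<open>h\<close> is a chart from the plane onto the sphere without \<open>b\<close>, and \<open>k\<close> is its inverse.\<close>
  obtain b where b: "b \<in> D" using assms(3) in_components_nonempty by blast
  define m where "m = (case b of Fin a \<Rightarrow> invert_at a | Infty \<Rightarrow> id)"
  have m: "m (m x) = x" "isCont m x" "m b = Infty" for x
    by (cases b; auto simp: m_def isCont_invert_at id_def)+
  define h where "h = m \<circ> Fin"
  define k where "k = coord \<circ> m"
  have contm: "continuous_on S m" for S by (simp add: m continuous_at_imp_continuous_on)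
  have conth: "continuous_on S h" for S
    unfolding h_def by (intro continuous_on_compose continuous_on_Fin contm)
  have contk: "continuous_on (-{b}) k"
  proof -
    have "m x \<noteq> Infty" if "x \<noteq> b" for x using m(1)[of x] m(1)[of b] m(3) that by metis
    then show ?thesis unfolding k_def
      by (intro continuous_on_compose contm continuous_at_imp_continuous_on) (auto intro: isCont_coord)
  qed
  have hk: "h (k x) = x" if "x \<noteq> b" for x
  proof -
    have "m x \<noteq> Infty" using m(1)[of x] m(1)[of b] m(3) that by metis
    then obtain z where "m x = Fin z" by (cases "m x") auto
    then show ?thesis using m(1)[of x] by (simp add: h_def k_def)
  qed
  have hb: "h z \<noteq> b" for z using m(1)[of "Fin z"] m(3) by (auto simp: h_def)
  have kh: "k (h z) = z" for z by (simp add: h_def k_def m)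
  have bg: "b \<notin> path_image \<gamma>" using b D by blast
  have hkg: "h (k x) = x" if "x \<in> path_image \<gamma>" for x using hk[of x] bg that by blast
  define c where "c = k \<circ> \<gamma>"
  have im: "path_image c = k ` path_image \<gamma>" by (simp add: c_def path_image_compose)
  have "path c" unfolding c_def using assms(1) bg
    by (intro path_continuous_image simple_path_imp_path continuous_on_subset[OF contk]) auto
  moreover have "inj_on k (path_image \<gamma>)" by (rule inj_on_inverseI[of _ h]) (rule hkg)
  ultimately have c: "simple_path c"
    using assms(1) unfolding simple_path_def loop_free_def c_def path_image_def inj_on_def by auto
  have cl: "pathfinish c = pathstart c" using assms(2) by (simp add: c_def pathfinish_def pathstart_def)
  have hc: "h ` path_image c = path_image \<gamma>" unfolding im image_image using hkg by simp
  note J = Jordan_inside_outside[OF c cl]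
  \<comment> \<open>The side of \<open>c\<close> that contains \<open>k y\<close> is carried by \<open>h\<close> into \<open>D\<close>.\<close>
  have "D \<noteq> {b}" using \<open>open D\<close> not_open_singleton by auto
  then obtain y where y: "y \<in> D" "y \<noteq> b" using b by blast
  have "k y \<notin> path_image c"
  proof
    assume "k y \<in> path_image c"
    then have "h (k y) \<in> path_image \<gamma>" using hc by blast
    then show False using y D hk by auto
  qed
  moreover
  have un: "inside (path_image c) \<union> outside (path_image c) = - path_image c" using J by simp
  moreover have sub: "inside (path_image c) \<subseteq> - path_image c" "outside (path_image c) \<subseteq> - path_image c"
    using un by blast+
  ultimately have "k y \<in> inside (path_image c) \<or> k y \<in> outside (path_image c)" by blast
  then obtain S where S: "k y \<in> S" "connected S" "S \<subseteq> - path_image c" "frontier S = path_image c"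
  proof
    assume "k y \<in> inside (path_image c)"
    then show ?thesis using that[of "inside (path_image c)"] J sub by simp
  next
    assume "k y \<in> outside (path_image c)"
    then show ?thesis using that[of "outside (path_image c)"] J sub by simp
  qed
  have "h ` S \<subseteq> - path_image \<gamma>"
  proof safe
    fix z assume "z \<in> S" "h z \<in> path_image \<gamma>"
    then have "k (h z) \<in> path_image c" using im by blast
    then show False using \<open>z \<in> S\<close> S kh by auto
  qed
  moreover have "y \<in> h ` S" using S hk y by force
  ultimately have "h ` S \<subseteq> D"
    using components_maximal[OF assms(3)] connected_continuous_image[OF conth S(2)] y by blast
  then have "closure (h ` S) \<subseteq> closure D" by (rule closure_mono)
  moreover have "h ` closure S \<subseteq> closure (h ` S)"
    by (rule image_closure_subset[OF conth]) (auto simp: closure_subset)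
  moreover have "path_image c \<subseteq> closure S" using S(4) by (auto simp: frontier_def)
  ultimately have "path_image \<gamma> \<subseteq> closure D" using hc by blast
  then have 1: "path_image \<gamma> \<subseteq> frontier D" using D \<open>open D\<close> by (auto simp: frontier_def interior_open)
  have "frontier D \<subseteq> path_image \<gamma>"
  proof
    fix x assume x: "x \<in> frontier D"
    show "x \<in> path_image \<gamma>"
    proof (rule ccontr)
      assume "x \<notin> path_image \<gamma>"
      then obtain V where V: "open V" "connected V" "x \<in> V" "V \<subseteq> - path_image \<gamma>"
        using exists_connected_open_neighbourhood[of "- path_image \<gamma>" x] clo by auto
      have "V \<inter> D \<noteq> {}" using V x open_Int_closure_eq_empty[of V D] by (auto simp: frontier_def)
      then have "V \<subseteq> D" using components_maximal[OF assms(3) V(2,4)] by blast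
      then show False using x V \<open>open D\<close> by (auto simp: frontier_def interior_open)
    qed
  qed
  with 1 show "frontier D = path_image \<gamma>" by blast
qed

lemma jordan_region_properties:
  assumes "jordan_region D"
  shows "open D" "connected D" "connected (frontier D)" "frontier D \<noteq> {}"
proof -
  from assms obtain \<gamma> where g: "simple_path \<gamma>" "pathfinish \<gamma> = pathstart \<gamma>" "D \<in> components (- path_image \<gamma>)"
    unfolding jordan_region_def by blast
  show "open D" "connected (frontier D)" "frontier D \<noteq> {}" "connected D"
    using frontier_Jordan_region[OF g] g
    by (auto simp: connected_path_image simple_path_imp_path in_components_connected)
qed

text \<open>
  A frontier, being connected, cannot leave a region without crossing its frontier. So \<open>frontier D\<close> lies
  in \<open>E\<close>; and \<open>frontier E\<close> does not meet \<open>D\<close>, as otherwise \<open>D \<union> E\<close> would be open and closed.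
  Therefore \<open>D\<close>, which meets \<open>E\<close>, lies in \<open>E\<close> as well.
\<close>

lemma nested_regions:
  fixes D E :: "riemann_sphere set"
  assumes D: "open D" "connected D" "connected (frontier D)"
    and E: "open E" "connected (frontier E)" "frontier E \<noteq> {}"
    and disj: "frontier D \<inter> frontier E = {}" and meet: "frontier D \<inter> E \<noteq> {}"
    and notall: "D \<union> E \<noteq> UNIV"
  shows "closure D \<subseteq> E"
proof -
  have DE: "frontier D \<subseteq> E" using connected_Int_frontier[OF D(3) meet] disj by blast
  have "D \<inter> frontier E = {}"
  proof (rule ccontr)
    assume "D \<inter> frontier E \<noteq> {}"
    then have "frontier E \<inter> D \<noteq> {}" by blast
    then have "frontier E \<subseteq> D" using connected_Int_frontier[OF E(2), of D] disj by blast
    moreover have "closure (D \<union> E) = D \<union> E \<union> frontier D \<union> frontier E"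
      using D(1) E(1) by (auto simp: frontier_def interior_open closure_Un dest: subsetD[OF closure_subset])
    ultimately have "closure (D \<union> E) = D \<union> E" using DE by blast
    then have "closed (D \<union> E)" by (metis closed_closure)
    moreover have "open (D \<union> E)" using D E by blast
    ultimately have "D \<union> E = {}" using notall connected_UNIV_sphere unfolding connected_clopen by auto
    then show False using meet by auto
  qed
  moreover have "D \<inter> E \<noteq> {}"
    using meet open_Int_closure_eq_empty[OF E(1), of D] by (auto simp: frontier_def)
  ultimately have "D \<subseteq> E" using connected_Int_frontier[OF D(2), of E] by blast
  moreover have "closure D = D \<union> frontier D"
    using D(1) by (auto simp: frontier_def interior_open dest: subsetD[OF closure_subset])
  ultimately show ?thesis using DE by blast
qed

section \<open>Segments ending on a carpet\<close>

text \<open>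
  If no region containing \<open>c\<close> reached \<open>x\<close>, every such region would lie strictly inside another one, and
  there would be infinitely many. None of them contains \<open>x\<close> or \<open>z\<close>, so all frontiers beyond a fixed
  region would meet both \<open>[x, c]\<close> and a segment \<open>[c', z]\<close> disjoint from it, against the diameters tending
  to zero. The point \<open>z\<close> is not real in order that the second segment leaves the first one alone.
\<close>

lemma segment_ends_at_region:
  fixes D :: "nat \<Rightarrow> riemann_sphere set" and x c :: real and z :: complex
  assumes jordan: "\<And>i. jordan_region (D i)"
    and disj: "\<And>i j. i \<noteq> j \<Longrightarrow> frontier (D i) \<inter> frontier (D j) = {}"
    and diam: "(\<lambda>i. diameter (frontier (D i))) \<longlonglongrightarrow> 0"
    and x: "\<And>i. Fin x \<notin> D i" and "x \<noteq> c"
    and seg: "\<And>t. t \<in> closed_segment x c \<Longrightarrow> t \<noteq> x \<Longrightarrow> \<exists>i. Fin (of_real t) \<in> D i"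
    and z: "Im z \<noteq> 0" "\<And>i. Fin c \<in> D i \<Longrightarrow> Fin z \<notin> D i"
  obtains i where "Fin c \<in> D i" "Fin x \<in> frontier (D i)"
proof (rule ccontr)
  assume no: "\<not> thesis"
  note witness = that
  note D = jordan_region_properties[OF jordan]
  define C where "C = (\<lambda>t. Fin (of_real t)) ` (closed_segment x c - {x})"
  define I where "I = {i. Fin c \<in> D i}"
  have xno: "Fin x \<notin> closure (D i)" if "i \<in> I" for i
    using no witness[of i] that x[of i] D(1)[of i] by (auto simp: I_def frontier_def interior_open)
  have conC: "connected (closed_segment x c - {x})"
  proof -
    have "closed_segment x c - {x} = (if x < c then {x<..c} else {c..<x})"
      using \<open>x \<noteq> c\<close> by (auto simp: closed_segment_eq_real_ivl)
    then show ?thesis by simp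
  qed
  have cont: "continuous_on S (\<lambda>t::real. Fin (of_real t))" for S
    by (intro continuous_on_compose2[OF continuous_on_Fin[of UNIV]] continuous_intros) auto
  have "connected C" unfolding C_def by (intro connected_continuous_image cont conC)
  have "x \<in> closure (closed_segment x c - {x})"
  proof -
    have "closed_segment x c - {x} = (if x < c then {x<..c} else {c..<x})"
      using \<open>x \<noteq> c\<close> by (auto simp: closed_segment_eq_real_ivl)
    then show ?thesis using \<open>x \<noteq> c\<close> by auto
  qed
  then have "Fin x \<in> closure C" unfolding C_def
    using image_closure_subset[OF cont closed_closure closure_subset] by blast
  \<comment> \<open>A region containing \<open>c\<close> that does not reach \<open>x\<close> is left by the segment, at a point of a larger region.\<close>
  have bigger: "\<exists>j\<in>I. D i \<subset> D j" if "i \<in> I" for i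
  proof -
    have "\<not> C \<subseteq> D i" using xno[OF that] \<open>Fin x \<in> closure C\<close> closure_mono by blast
    moreover have "Fin c \<in> C \<inter> D i" using that \<open>x \<noteq> c\<close> by (auto simp: C_def I_def)
    ultimately have "C \<inter> frontier (D i) \<noteq> {}" using connected_Int_frontier[OF \<open>connected C\<close>, of "D i"] by blast
    then obtain p where p: "p \<in> C" "p \<in> frontier (D i)" by blast
    then obtain j where j: "p \<in> D j" using seg unfolding C_def by auto
    have "p \<notin> D i" using p D(1)[of i] by (auto simp: frontier_def interior_open)
    with j have "i \<noteq> j" by auto
    have "closure (D i) \<subseteq> D j"
      by (rule nested_regions) (use D disj[OF \<open>i \<noteq> j\<close>] p j x[of i] x[of j] in auto)
    then have "D i \<subset> D j" using closure_subset[of "D i"] \<open>p \<notin> D i\<close> j by blast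
    moreover have "j \<in> I" using that calculation by (auto simp: I_def)
    ultimately show ?thesis by blast
  qed
  obtain i0 where i0: "i0 \<in> I" using seg[of c] \<open>x \<noteq> c\<close> by (auto simp: I_def)
  define J where "J = {j \<in> I. D i0 \<subseteq> D j}"
  have "infinite J"
  proof
    assume "finite J"
    moreover have "J \<noteq> {}" using i0 by (auto simp: J_def)
    ultimately have "\<exists>m\<in>D ` J. \<forall>b\<in>D ` J. m \<le> b \<longrightarrow> m = b" by (intro finite_has_maximal) auto
    then obtain i where i: "i \<in> J" "\<And>j. j \<in> J \<Longrightarrow> D i \<subseteq> D j \<Longrightarrow> D i = D j" by auto
    have "i \<in> I" using i(1) by (simp add: J_def)
    then obtain j where "j \<in> I" "D i \<subset> D j" using bigger by blast
    with i show False by (auto simp: J_def)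
  qed
  have "open ((\<lambda>t::real. Fin (of_real t)) -` D i0)" by (intro open_vimage D cont)
  moreover have "c \<in> (\<lambda>t::real. Fin (of_real t)) -` D i0" using i0 by (simp add: I_def)
  ultimately obtain e where e: "e > 0" "ball c e \<subseteq> (\<lambda>t::real. Fin (of_real t)) -` D i0" by (rule openE)
  \<comment> \<open>The point \<open>c'\<close> lies in the base region \<open>D i0\<close>, just beyond \<open>c\<close> as seen from \<open>x\<close>.\<close>
  define c' where "c' = c + (if x < c then e / 2 else - e / 2)"
  have "c' \<in> ball c e" using e(1) by (auto simp: c'_def dist_real_def)
  with e(2) have c': "Fin c' \<in> D i0" by blast
  have c'x: "c' \<notin> closed_segment x c" using \<open>x \<noteq> c\<close> e(1) by (auto simp: c'_def closed_segment_eq_real_ivl)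
  define A where "A = (\<lambda>t. Fin (of_real t)) ` closed_segment x c"
  define B where "B = Fin ` closed_segment (of_real c') z"
  have AB: "compact A" "compact B" "connected A" "connected B" "A \<noteq> {}" "B \<noteq> {}"
    by (auto simp: A_def B_def intro!: compact_continuous_image connected_continuous_image cont continuous_on_Fin)
  have "A \<inter> B = {}"
  proof -
    have False if t: "t \<in> closed_segment x c" "of_real t \<in> closed_segment (complex_of_real c') z" for t
    proof -
      from t(2) obtain u where u: "complex_of_real t = (1 - u) *\<^sub>R of_real c' + u *\<^sub>R z" unfolding in_segment by auto
      then have "u * Im z = 0" by (auto simp: complex_eq_iff)
      with z u have "complex_of_real t = of_real c'" by simp
      with t(1) c'x show False by simp
    qed
    then show ?thesis by (auto simp: A_def B_def)
  qed
  have "\<exists>p\<in>A \<times> B. \<forall>q\<in>A \<times> B. dist (fst p) (snd p) \<le> dist (fst q) (snd q)"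
    by (intro continuous_attains_inf compact_Times AB continuous_intros) (use AB in auto)
  then obtain a0 b0 where ab0: "a0 \<in> A" "b0 \<in> B" "\<And>a b. a \<in> A \<Longrightarrow> b \<in> B \<Longrightarrow> dist a0 b0 \<le> dist a b"
    by auto
  then have "dist a0 b0 > 0" using \<open>A \<inter> B = {}\<close> by auto
  with ab0(3) obtain d where d: "d > 0" "\<And>a b. a \<in> A \<Longrightarrow> b \<in> B \<Longrightarrow> d \<le> dist a b" by blast
  have big: "d \<le> diameter (frontier (D j))" if "j \<in> J" for j
  proof -
    have "Fin c \<in> A \<inter> D j" "Fin x \<in> A - D j" using that x[of j] by (auto simp: A_def J_def I_def)
    then obtain a where a: "a \<in> A" "a \<in> frontier (D j)" using connected_Int_frontier[OF AB(3), of "D j"] by blast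
    have "Fin c' \<in> B \<inter> D j" "Fin z \<in> B - D j" using that z c' by (auto simp: B_def J_def I_def)
    then obtain b where b: "b \<in> B" "b \<in> frontier (D j)" using connected_Int_frontier[OF AB(4), of "D j"] by blast
    have "dist u v \<le> pi" for u v :: riemann_sphere
      unfolding dist_riemann_sphere_def
      using Cauchy_Schwarz_ineq2[of "stereo u" "stereo v"] by (intro arccos_ubound) auto
    then have "bounded (frontier (D j))" unfolding bounded_def by blast
    from diameter_bounded_bound[OF this a(2) b(2)] d(2)[OF a(1) b(1)] show ?thesis by linarith
  qed
  have "eventually (\<lambda>j. diameter (frontier (D j)) < d) sequentially"
    using order_tendstoD(2)[OF diam d(1)] .
  then obtain n where "\<And>j. j \<ge> n \<Longrightarrow> diameter (frontier (D j)) < d" by (auto simp: eventually_sequentially)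
  moreover obtain j where "j \<ge> n" "j \<in> J" using \<open>infinite J\<close> unfolding infinite_nat_iff_unbounded_le by blast
  ultimately show False using big[of j] by force
qed

text \<open>
  The condition on \<open>closure A\<close> says that \<open>A\<close> is closed in the complement of \<open>S\<close>, so every complementary
  region lies in \<open>A\<close> or avoids it. The two segments end at regions of different kinds, which
  would share the frontier point \<open>x\<close>.
\<close>

lemma not_sierpinski_carpet_if_two_sided:
  fixes x c1 c2 :: real
  assumes A: "open A" "A \<subseteq> - S" "closure A \<inter> - S \<subseteq> A"
    and S: "Fin x \<in> S"
    and c1: "c1 \<noteq> x" "\<And>t. t \<in> closed_segment x c1 \<Longrightarrow> t \<noteq> x \<Longrightarrow> Fin (of_real t) \<in> A"
    and c2: "c2 \<noteq> x" "\<And>t. t \<in> closed_segment x c2 \<Longrightarrow> t \<noteq> x \<Longrightarrow> Fin (of_real t) \<in> - S - A"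
  shows "\<not> sierpinski_carpet S"
proof
  assume carpet: "sierpinski_carpet S"
  then obtain D :: "nat \<Rightarrow> riemann_sphere set" where D: "S = UNIV - (\<Union>i. D i)" "\<And>i. jordan_region (D i)"
    "\<And>i j. i \<noteq> j \<Longrightarrow> frontier (D i) \<inter> frontier (D j) = {}"
    "(\<lambda>i. diameter (frontier (D i))) \<longlonglongrightarrow> 0"
    unfolding sierpinski_carpet_def by blast
  have "closed S" using carpet by (auto simp: sierpinski_carpet_def compact_imp_closed)
  have side: "D i \<subseteq> A" if "D i \<inter> A \<noteq> {}" for i
  proof (rule ccontr)
    assume "\<not> D i \<subseteq> A"
    then have "D i - A \<noteq> {}" by blast
    with that have "D i \<inter> frontier A \<noteq> {}"
      by (rule connected_Int_frontier[OF jordan_region_properties(2)[OF D(2)]])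
    then obtain p where p: "p \<in> D i" "p \<in> frontier A" by blast
    then have "p \<in> - S" using D(1) by auto
    with p A show False by (auto simp: frontier_def interior_open)
  qed
  have nonreal: "\<exists>z. Im z \<noteq> 0 \<and> Fin z \<in> V" if "open V" "Fin (of_real c) \<in> V" for V c
  proof -
    have "open (Fin -` V)" by (intro open_vimage that(1) continuous_on_Fin)
    moreover have "of_real c \<in> Fin -` V" using that(2) by simp
    ultimately obtain e where e: "e > 0" "ball (of_real c) e \<subseteq> Fin -` V" by (rule openE)
    have "Complex c (e / 2) \<in> ball (of_real c) e" using e(1)
      by (simp add: dist_norm complex_of_real_def cmod_def)
    with e show ?thesis by (intro exI[of _ "Complex c (e / 2)"]) auto
  qed
  have c1A: "Fin c1 \<in> A" using c1 by simp
  have c2B: "Fin c2 \<in> - S - A" using c2 by simp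
  \<comment> \<open>A region on one side of the separation omits every point of the other side.\<close>
  obtain z1 where z1: "Im z1 \<noteq> 0" "Fin z1 \<in> A" using nonreal[OF A(1) c1A] by blast
  have eq: "- S - A = - S \<inter> - closure A" using A closure_subset[of A] by blast
  have "open (- S - A)" unfolding eq by (intro open_Int open_Compl \<open>closed S\<close> closed_closure)
  from nonreal[OF this c2B] obtain z2 where z2: "Im z2 \<noteq> 0" "Fin z2 \<in> - S - A" by blast
  have x: "Fin x \<notin> D i" for i using S D(1) by blast
  obtain i where i: "Fin c1 \<in> D i" "Fin x \<in> frontier (D i)"
  proof (rule segment_ends_at_region[OF D(2-4) x])
    show "Fin z2 \<notin> D i" if "Fin c1 \<in> D i" for i using side[of i] that c1A z2 by blast
  qed (use c1 A(2) D(1) z2 in blast)+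
  obtain j where j: "Fin c2 \<in> D j" "Fin x \<in> frontier (D j)"
  proof (rule segment_ends_at_region[OF D(2-4) x])
    show "Fin z1 \<notin> D i" if "Fin c2 \<in> D i" for i using side[of i] that c2B z1 by blast
  qed (use c2 D(1) z1 in blast)+
  have "D i \<subseteq> A" using side[of i] i c1A by blast
  with j c2B have "i \<noteq> j" by blast
  with D(3)[OF this] i j show False by blast
qed

section \<open>Attracting basins and the Fatou set\<close>

lemma compact_insert_limit:
  assumes "f \<longlonglongrightarrow> (l :: 'a :: topological_space)"
  shows "compact (insert l (range f))"
proof (rule compactI)
  fix \<C> :: "'a set set" assume C: "\<forall>T\<in>\<C>. open T" "insert l (range f) \<subseteq> \<Union>\<C>"
  then obtain T where T: "T \<in> \<C>" "l \<in> T" by auto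
  with C assms have "eventually (\<lambda>n. f n \<in> T) sequentially" by (auto dest: topological_tendstoD)
  then obtain n where n: "\<And>m. m \<ge> n \<Longrightarrow> f m \<in> T" by (auto simp: eventually_sequentially)
  have "\<forall>m. \<exists>V\<in>\<C>. f m \<in> V" using C(2) by auto
  then obtain V where V: "\<And>m. V m \<in> \<C>" "\<And>m. f m \<in> V m" by metis
  have "insert l (range f) \<subseteq> \<Union>(insert T (V ` {..<n}))"
  proof safe
    fix m show "f m \<in> \<Union>(insert T (V ` {..<n}))" using n[of m] V(2)[of m] by (cases "m < n") auto
  qed (use T in auto)
  moreover have "insert T (V ` {..<n}) \<subseteq> \<C>" using T V by auto
  ultimately show "\<exists>\<C>'\<subseteq>\<C>. finite \<C>' \<and> insert l (range f) \<subseteq> \<Union>\<C>'"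
    by (intro exI[of _ "insert T (V ` {..<n})"]) auto
qed

text \<open>
  A sequence drawn from \<open>F\<close> repeats one member infinitely often, which gives a constant subsequence, or
  its indices tend to infinity.
\<close>

lemma normal_family_on_range:
  assumes lim: "uniform_limit W F g sequentially"
  shows "normal_family_on W (range F)"
  unfolding normal_family_on_def
proof safe
  fix f :: "nat \<Rightarrow> 'a \<Rightarrow> 'b" assume f: "range f \<subseteq> range F"
  then have "\<forall>m. \<exists>k. f m = F k" by auto
  then obtain p where p: "\<And>m. f m = F (p m)" by metis
  show "\<exists>r g. strict_mono (r :: nat \<Rightarrow> nat) \<and>
      (\<forall>K. compact K \<and> K \<subseteq> W \<longrightarrow> uniform_limit K (\<lambda>n. f (r n)) g sequentially)"
  proof (cases "\<exists>v. infinite {m. p m = v}")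
    case True
    then obtain v where v: "infinite {m. p m = v}" by blast
    have "f (enumerate {m. p m = v} n) = F v" for n using enumerate_in_set[OF v, of n] p by simp
    then have "uniform_limit K (\<lambda>n. f (enumerate {m. p m = v} n)) (F v) sequentially" for K
      by (simp add: uniform_limit_iff)
    then show ?thesis using strict_mono_enumerate[OF v] by blast
  next
    case False
    have "filterlim p at_top sequentially"
      unfolding filterlim_at_top
    proof
      fix Z
      have "finite (\<Union>v<Z. {m. p m = v})" using False by auto
      then have "\<forall>\<^sub>F m in sequentially. m \<notin> (\<Union>v<Z. {m. p m = v})"
        unfolding cofinite_eq_sequentially[symmetric] eventually_cofinite
        by (simp only: not_not Collect_mem_eq)
      then show "\<forall>\<^sub>F m in sequentially. Z \<le> p m" by eventually_elim auto
    qed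
    then have "uniform_limit W (\<lambda>n. F (p n)) g sequentially"
      by (rule filterlim_compose[OF lim])
    then have "uniform_limit K (\<lambda>n. f (id n)) g sequentially" if "K \<subseteq> W" for K
      using that by (simp add: p uniform_limit_on_subset)
    then show ?thesis using strict_mono_id by blast
  qed
qed

text \<open>The basin of an attractor with trapping neighbourhood \<open>N\<close>.\<close>

definition basin :: "('a \<Rightarrow> 'a) \<Rightarrow> 'a set \<Rightarrow> 'a set" where
  "basin f N = (\<Union>n. (f ^^ n) -` N)"

lemma continuous_on_funpow:
  assumes "continuous_on UNIV (f :: 'a \<Rightarrow> 'a :: topological_space)"
  shows "continuous_on S (f ^^ n)"
proof (induction n)
  case (Suc n)
  have "continuous_on ((f ^^ n) ` S) f" using assms by (rule continuous_on_subset) simp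
  with Suc show ?case unfolding funpow.simps by (intro continuous_on_compose)
qed (simp add: id_def)

lemma open_basin:
  assumes "continuous_on UNIV f" "open N"
  shows "open (basin f N)"
  unfolding basin_def by (intro open_UN ballI open_vimage assms continuous_on_funpow)

lemma uniform_limit_preimage:
  assumes lim: "uniform_limit N (\<lambda>n. f ^^ n) (\<lambda>_. a) sequentially"
  shows "uniform_limit ((f ^^ k) -` N) (\<lambda>n. f ^^ n) (\<lambda>_. a) sequentially"
  unfolding uniform_limit_iff
proof safe
  fix e :: real assume "e > 0"
  with lim have "\<forall>\<^sub>F n in sequentially. \<forall>x\<in>N. dist ((f ^^ n) x) a < e" unfolding uniform_limit_iff by blast
  then have "\<forall>\<^sub>F n in sequentially. \<forall>x\<in>(f ^^ k) -` N. dist ((f ^^ (n + k)) x) a < e"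
    by eventually_elim (simp add: funpow_add)
  then show "\<forall>\<^sub>F n in sequentially. \<forall>x\<in>(f ^^ k) -` N. dist ((f ^^ n) x) a < e"
    by (simp add: eventually_sequentially_seg[of "\<lambda>n. \<forall>x\<in>(f ^^ k) -` N. dist ((f ^^ n) x) a < e"])
qed

lemma basin_tendsto:
  assumes "uniform_limit N (\<lambda>n. f ^^ n) (\<lambda>_. a) sequentially" "x \<in> basin f N"
  shows "(\<lambda>n. (f ^^ n) x) \<longlonglongrightarrow> a"
  using assms(2) tendsto_uniform_limitI[OF uniform_limit_preimage[OF assms(1)]]
  by (auto simp: basin_def)

lemma basin_subset_fatou_set:
  assumes cont: "continuous_on UNIV f" and N: "open N"
    and lim: "uniform_limit N (\<lambda>n. f ^^ n) (\<lambda>_. a) sequentially"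
  shows "basin f N \<subseteq> fatou_set f"
proof
  fix x assume "x \<in> basin f N"
  then obtain k where k: "x \<in> (f ^^ k) -` N" by (auto simp: basin_def)
  have "open ((f ^^ k) -` N)" by (intro open_vimage N continuous_on_funpow cont)
  with k show "x \<in> fatou_set f"
    using normal_family_on_range[OF uniform_limit_preimage[OF lim]] unfolding fatou_set_def by blast
qed

text \<open>
  A locally uniform limit of a subsequence of the iterates is continuous, so it has the value \<open>a\<close> also at a Fatou
  point on the frontier of the basin; hence the orbit of that point enters \<open>N\<close>.
\<close>

lemma closure_basin_Int_fatou_set:
  assumes cont: "continuous_on UNIV f" and N: "open N" "a \<in> N"
    and lim: "uniform_limit N (\<lambda>n. f ^^ n) (\<lambda>_. a) sequentially"
  shows "closure (basin f N) \<inter> fatou_set f \<subseteq> basin f N"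
proof safe
  fix x assume x: "x \<in> closure (basin f N)" "x \<in> fatou_set f"
  then obtain W where W: "open W" "x \<in> W" "normal_family_on W (range (\<lambda>n. f ^^ n))"
    unfolding fatou_set_def by blast
  have "x \<in> closure (W \<inter> basin f N)" using x(1) W open_Int_closure_subset by blast
  then obtain z where z: "\<And>n. z n \<in> W \<inter> basin f N" "z \<longlonglongrightarrow> x" unfolding closure_sequential by blast
  \<comment> \<open>A compact set on which continuity of the limit can be used at \<open>x\<close>.\<close>
  define K where "K = insert x (range z)"
  have K: "compact K" "K \<subseteq> W" unfolding K_def using compact_insert_limit[OF z(2)] W z by auto
  obtain r g where r: "strict_mono (r :: nat \<Rightarrow> nat)" and g: "uniform_limit K (\<lambda>n. f ^^ (r n)) g sequentially"
    using W(3)[unfolded normal_family_on_def, rule_format, of "\<lambda>n. f ^^ n"] K by auto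
  have "continuous_on K g"
    by (rule uniform_limit_theorem[OF _ g]) (simp_all add: continuous_on_funpow cont)
  then have "(\<lambda>n. g (z n)) \<longlonglongrightarrow> g x"
    by (rule continuous_on_tendsto_compose[OF _ z(2)]) (auto simp: K_def)
  moreover have "g (z n) = a" for n
  proof (rule LIMSEQ_unique)
    show "(\<lambda>m. (f ^^ r m) (z n)) \<longlonglongrightarrow> g (z n)" by (rule tendsto_uniform_limitI[OF g]) (simp add: K_def)
    show "(\<lambda>m. (f ^^ r m) (z n)) \<longlonglongrightarrow> a"
      using LIMSEQ_subseq_LIMSEQ[OF basin_tendsto[OF lim, of "z n"] r] z(1)[of n] by (simp add: o_def)
  qed
  ultimately have "g x = a" by (simp add: LIMSEQ_const_iff)
  have "(\<lambda>m. (f ^^ r m) x) \<longlonglongrightarrow> g x" by (rule tendsto_uniform_limitI[OF g]) (simp add: K_def)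
  then have "eventually (\<lambda>m. (f ^^ r m) x \<in> N) sequentially"
    unfolding \<open>g x = a\<close> using N by (rule topological_tendstoD)
  then obtain m where "(f ^^ r m) x \<in> N" by (auto simp: eventually_sequentially)
  then show "x \<in> basin f N" by (auto simp: basin_def)
qed

text \<open>
  If \<open>T\<close> carries \<open>x\<close> into the basin of \<open>a\<close>, then \<open>x\<close> is attracted to \<open>T a\<close>: the map \<open>T\<close> commutes with \<open>T \<circ> T\<close>,
  so uniform convergence near \<open>T x\<close> is transported by the continuity of \<open>T\<close> at \<open>a\<close>.
\<close>

lemma preimage_basin:
  assumes cont: "continuous_on UNIV T" and N: "open N"
    and lim: "uniform_limit N (\<lambda>n. (T \<circ> T) ^^ n) (\<lambda>_. a) sequentially"
    and a: "T a \<noteq> a" and x: "T x \<in> basin (T \<circ> T) N"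
  shows "x \<in> fatou_set (T \<circ> T) - basin (T \<circ> T) N"
proof
  have contU: "continuous_on UNIV (T \<circ> T)"
    using cont by (intro continuous_on_compose) (auto intro: continuous_on_subset)
  have swap: "((T \<circ> T) ^^ n) (T y) = T (((T \<circ> T) ^^ n) y)" for n y
    by (induction n arbitrary: y) (simp_all add: funpow_swap1)
  have Ta: "T \<midarrow>a\<rightarrow> T a" using cont by (simp add: continuous_on_eq_continuous_at isCont_def)
  from x obtain k where k: "((T \<circ> T) ^^ k) (T x) \<in> N" by (auto simp: basin_def)
  define W where "W = T -` (((T \<circ> T) ^^ k) -` N)"
  have "open W" unfolding W_def by (intro open_vimage N continuous_on_funpow contU cont)
  have lim': "uniform_limit W (\<lambda>n. (T \<circ> T) ^^ n) (\<lambda>_. T a) sequentially"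
    unfolding uniform_limit_iff
  proof safe
    fix e :: real assume "e > 0"
    with cont obtain d where d: "d > 0" "\<And>y. dist y a < d \<Longrightarrow> dist (T y) (T a) < e"
      unfolding continuous_on_iff by blast
    from uniform_limit_preimage[OF lim, of k] d(1)
    have "\<forall>\<^sub>F n in sequentially. \<forall>y\<in>((T \<circ> T) ^^ k) -` N. dist (((T \<circ> T) ^^ n) y) a < d"
      unfolding uniform_limit_iff by blast
    then have "\<forall>\<^sub>F n in sequentially. \<forall>y\<in>W. dist (((T \<circ> T) ^^ (Suc n)) y) (T a) < e"
    proof eventually_elim
      case (elim n)
      have "((T \<circ> T) ^^ (Suc n)) y = T (((T \<circ> T) ^^ n) (T y))" for y
        by (simp add: swap)
      then show ?case using elim d(2) by (auto simp: W_def simp del: funpow.simps)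
    qed
    then show "\<forall>\<^sub>F n in sequentially. \<forall>y\<in>W. dist (((T \<circ> T) ^^ n) y) (T a) < e"
      by (subst (asm) eventually_sequentially_Suc)
  qed
  have "x \<in> W" using k by (simp add: W_def)
  then show "x \<in> fatou_set (T \<circ> T)"
    using normal_family_on_range[OF lim'] \<open>open W\<close> unfolding fatou_set_def by blast
  show "x \<notin> basin (T \<circ> T) N"
  proof
    assume "x \<in> basin (T \<circ> T) N"
    from basin_tendsto[OF lim this] tendsto_uniform_limitI[OF lim' \<open>x \<in> W\<close>] show False
      using a LIMSEQ_unique by blast
  qed
qed

definition outer_disc :: "real \<Rightarrow> riemann_sphere set" where
  "outer_disc r = insert Infty (Fin ` {z. r < cmod z})"

lemma Infty_in_outer_disc [simp]: "Infty \<in> outer_disc r"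
  and Fin_in_outer_disc [simp]: "Fin z \<in> outer_disc r \<longleftrightarrow> r < cmod z"
  by (auto simp: outer_disc_def)

lemma open_outer_disc: "open (outer_disc r)"
  unfolding open_iff_eventually
proof
  fix x assume x: "x \<in> outer_disc r"
  show "eventually (\<lambda>y. y \<in> outer_disc r) (nhds x)"
  proof (cases x)
    case (Fin z)
    have "open {z::complex. r < cmod z}" by (intro open_Collect_less continuous_intros)
    from eventually_nhds_in_open[OF this, of z] x show ?thesis
      by (simp add: Fin eventually_nhds_Fin)
  next
    case Infty
    then show ?thesis by (auto simp: eventually_nhds_Infty intro!: exI[of _ "r + 1"])
  qed
qed

lemma uniform_limit_outer_disc:
  assumes "R > 0" and f: "\<And>r. r \<ge> R \<Longrightarrow> f ` outer_disc r \<subseteq> outer_disc (2 * r)"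
  shows "uniform_limit (outer_disc R) (\<lambda>n. f ^^ n) (\<lambda>_. Infty) sequentially"
  unfolding uniform_limit_iff
proof safe
  have iter: "(f ^^ n) ` outer_disc R \<subseteq> outer_disc (2 ^ n * R)" for n
  proof (induction n)
    case (Suc n)
    have "R \<le> 2 ^ n * R" using \<open>R > 0\<close> by simp
    from f[OF this] Suc show ?case by (fastforce simp: mult.assoc)
  qed simp
  fix e :: real assume "e > 0"
  have "eventually (\<lambda>y. y \<in> ball Infty e) (nhds Infty)" using \<open>e > 0\<close> by (intro eventually_nhds_in_open) auto
  then obtain r where r: "\<And>z. r \<le> cmod z \<Longrightarrow> dist (Fin z) Infty < e"
    unfolding eventually_nhds_Infty by (auto simp: dist_commute)
  obtain n0 where n0: "r / R < 2 ^ n0" using real_arch_pow[of 2 "r / R"] by auto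
  have "eventually (\<lambda>n. r \<le> 2 ^ n * R) sequentially"
    unfolding eventually_sequentially
  proof (intro exI allI impI)
    fix n assume "n0 \<le> n"
    then have "(2::real) ^ n0 \<le> 2 ^ n" by (intro power_increasing) auto
    with n0 have "r / R \<le> 2 ^ n" by linarith
    then show "r \<le> 2 ^ n * R" using \<open>R > 0\<close> by (simp add: pos_divide_le_eq)
  qed
  then show "\<forall>\<^sub>F n in sequentially. \<forall>x\<in>outer_disc R. dist ((f ^^ n) x) Infty < e"
  proof eventually_elim
    case (elim n)
    have "dist y Infty < e" if "y \<in> outer_disc (2 ^ n * R)" for y
      using that r elim \<open>e > 0\<close> by (cases y) auto
    then show ?case using iter[of n] by blast
  qed
qed

text \<open>
  The basin is open and closed in the Fatou set, so it serves as the separation of the complement of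
  the Julia set.
\<close>

lemma not_sierpinski_carpet_julia_set:
  fixes x c1 c2 :: real and f :: "riemann_sphere \<Rightarrow> riemann_sphere"
  assumes f: "continuous_on UNIV f" and N: "open N" "a \<in> N"
    and lim: "uniform_limit N (\<lambda>n. f ^^ n) (\<lambda>_. a) sequentially"
    and x: "Fin x \<notin> basin f N"
    and c1: "c1 \<noteq> x" "\<And>t. t \<in> closed_segment x c1 \<Longrightarrow> t \<noteq> x \<Longrightarrow> Fin (of_real t) \<in> basin f N"
    and c2: "c2 \<noteq> x" "\<And>t. t \<in> closed_segment x c2 \<Longrightarrow> t \<noteq> x \<Longrightarrow> Fin (of_real t) \<in> fatou_set f - basin f N"
  shows "\<not> sierpinski_carpet (julia_set f)"
proof (rule not_sierpinski_carpet_if_two_sided[where A = "basin f N" and x = x and ?c1.0 = c1 and ?c2.0 = c2])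
  note clos = closure_basin_Int_fatou_set[OF f N lim]
  show "Fin x \<in> julia_set f"
  proof -
    have "x \<in> closure (closed_segment x c1 - {x})"
    proof -
      have "closed_segment x c1 - {x} = (if x < c1 then {x<..c1} else {c1..<x})"
        using c1(1) by (auto simp: closed_segment_eq_real_ivl)
      then show ?thesis using c1(1) by auto
    qed
    moreover have "continuous_on S (\<lambda>t::real. Fin (of_real t))" for S
      by (intro continuous_on_compose2[OF continuous_on_Fin[of UNIV]] continuous_intros) auto
    moreover have "(\<lambda>t::real. Fin (of_real t)) ` (closed_segment x c1 - {x}) \<subseteq> basin f N"
      using c1(2) by auto
    ultimately have "Fin x \<in> closure (basin f N)"
      using image_closure_subset[of "closed_segment x c1 - {x}" "\<lambda>t::real. Fin (of_real t)" "closure (basin f N)"]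
        closure_subset[of "basin f N"] by blast
    then show ?thesis using clos x unfolding julia_set_def by blast
  qed
  show "open (basin f N)" by (rule open_basin[OF f N(1)])
  show "basin f N \<subseteq> - julia_set f" using basin_subset_fatou_set[OF f N(1) lim] by (simp add: julia_set_def)
  show "closure (basin f N) \<inter> - julia_set f \<subseteq> basin f N" using clos by (simp add: julia_set_def)
  show "Fin (of_real t) \<in> basin f N" if "t \<in> closed_segment x c1" "t \<noteq> x" for t using that by (rule c1)
  show "Fin (of_real t) \<in> - julia_set f - basin f N" if "t \<in> closed_segment x c2" "t \<noteq> x" for t
    using c2(2)[OF that] by (simp add: julia_set_def)
qed (use c1 c2 in auto)

section \<open>The renormalisation map\<close>

text \<open>
  The Potts renormalisation map \<open>z \<mapsto> (1 + l / (z - 1))\<^sup>d\<close>, a compositional square root of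
  \<^term>\<open>U d l\<close> that exchanges \<open>1\<close> and \<open>\<infinity>\<close>.
\<close>

definition renorm :: "nat \<Rightarrow> complex \<Rightarrow> riemann_sphere \<Rightarrow> riemann_sphere" where
  "renorm d l = affine_power d l \<circ> invert_at 1"

lemma renorm_Infty [simp]: "renorm d l Infty = Fin 1"
  and renorm_1 [simp]: "renorm d l (Fin 1) = Infty"
  and renorm_Fin: "z \<noteq> 1 \<Longrightarrow> renorm d l (Fin z) = Fin ((1 + l / (z - 1)) ^ d)"
  by (simp_all add: renorm_def)

lemma continuous_on_affine_power:
  "c \<noteq> 0 \<Longrightarrow> d > 0 \<Longrightarrow> continuous_on S (affine_power d c)"
  by (simp add: continuous_at_imp_continuous_on isCont_affine_power)

lemma continuous_on_renorm: "l \<noteq> 0 \<Longrightarrow> d > 0 \<Longrightarrow> continuous_on S (renorm d l)"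
  unfolding renorm_def
  by (intro continuous_on_compose continuous_on_invert_at continuous_on_affine_power)

lemma U_eq_renorm_renorm:
  assumes "l \<noteq> 0" "d > 0"
  shows "U d l = renorm d l \<circ> renorm d l"
proof
  fix x
  show "U d l x = (renorm d l \<circ> renorm d l) x"
  proof (cases x)
    case Infty
    then show ?thesis using U_Infty[OF assms(2)] by simp
  next
    case (Fin z)
    define a b where "a = (z + l - 1) ^ d" and "b = (z - 1) ^ d"
    have U: "U d l x = (if a - b = 0 then Infty else Fin (((a + (l - 1) * b) / (a - b)) ^ d))"
      unfolding Fin U_Fin[OF assms(1)] a_def b_def using assms(2) by simp
    show ?thesis
    proof (cases "z = 1")
      case True
      then have "b = 0" "a = l ^ d" using assms by (simp_all add: a_def b_def zero_power)
      then show ?thesis using U assms True Fin by simp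
    next
      case False
      have b: "b \<noteq> 0" using False by (simp add: b_def)
      have "1 + l / (z - 1) = (z + l - 1) / (z - 1)" using False by (simp add: field_simps)
      then have T: "renorm d l x = Fin (a / b)"
        using False by (simp add: Fin renorm_Fin a_def b_def power_divide)
      show ?thesis
      proof (cases "a = b")
        case True
        then show ?thesis using U T b by simp
      next
        case neq: False
        then have "a / b \<noteq> 1" using b by simp
        moreover have "1 + l / (a / b - 1) = (a + (l - 1) * b) / (a - b)"
          using b neq by (simp add: field_simps)
        ultimately show ?thesis using U T neq by (simp add: renorm_Fin)
      qed
    qed
  qed
qed

lemma U_0_eq_affine_power:
  assumes "d > 0"
  shows "U d 0 = affine_power d (1 / of_nat d)"
proof
  fix x
  show "U d 0 x = affine_power d (1 / of_nat d) x"
  proof (cases x)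
    case (Fin z)
    have "(z + of_nat d - 1) / of_nat d = 1 + 1 / of_nat d * (z - 1)" using assms by (simp add: field_simps)
    then show ?thesis unfolding Fin U_0_Fin[OF assms] affine_power.simps by simp
  qed (simp add: U_Infty assms)
qed

lemma norm_one_plus_power_minus_one:
  fixes u :: complex
  assumes "cmod u \<le> 1"
  shows "cmod ((1 + u) ^ n - 1) \<le> (2 ^ n - 1) * cmod u"
proof (induction n)
  case (Suc n)
  have eq: "(1 + u) ^ Suc n - 1 = (1 + u) * ((1 + u) ^ n - 1) + u" by (simp add: algebra_simps)
  have "cmod (1 + u) \<le> 2" using norm_triangle_ineq[of 1 u] assms by simp
  then have "cmod (1 + u) * cmod ((1 + u) ^ n - 1) \<le> 2 * ((2 ^ n - 1) * cmod u)"
    using Suc by (intro mult_mono) auto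
  then have "cmod ((1 + u) ^ Suc n - 1) \<le> 2 * ((2 ^ n - 1) * cmod u) + cmod u"
    unfolding eq using norm_triangle_ineq[of "(1 + u) * ((1 + u) ^ n - 1)" u] by (simp add: norm_mult)
  then show ?case by (simp add: algebra_simps)
qed simp

text \<open>
  Near \<open>\<infinity>\<close> the first application of the map lands at distance \<open>O(1 / \<bar>z\<bar>)\<close> from \<open>1\<close>, so the second
  one returns to order \<open>\<bar>z\<bar>\<^sup>d\<close>.
\<close>

lemma renorm_renorm_outer_disc:
  assumes "l \<noteq> 0" "d \<ge> 2"
  obtains R where "R > 0" "\<And>r. r \<ge> R \<Longrightarrow> (renorm d l \<circ> renorm d l) ` outer_disc r \<subseteq> outer_disc (2 * r)"
proof
  define C :: real where "C = 2 ^ d"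
  have C: "C \<ge> 1" by (simp add: C_def)
  \<comment> \<open>For \<open>\<bar>z\<bar> > R\<close> the base \<open>1 + v\<close> of the second power is at least \<open>\<bar>z\<bar> / (2 * C)\<close> in modulus, and the
    square of that exceeds \<open>2 * \<bar>z\<bar>\<close>. The summand \<open>cmod l + 1\<close> makes \<open>u\<close> below small.\<close>
  define R where "R = 32 * C\<^sup>2 + cmod l + 1"
  show "R > 0" by (simp add: R_def add_nonneg_pos)
  fix r assume r: "R \<le> r"
  show "(renorm d l \<circ> renorm d l) ` outer_disc r \<subseteq> outer_disc (2 * r)"
  proof
    fix y assume "y \<in> (renorm d l \<circ> renorm d l) ` outer_disc r"
    then obtain x where x: "x \<in> outer_disc r" "y = renorm d l (renorm d l x)" by auto
    show "y \<in> outer_disc (2 * r)"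
    proof (cases x)
      case (Fin z)
      have zr: "cmod z > r" using x Fin by simp
      have z1: "cmod (z - 1) \<ge> cmod z - 1" using norm_triangle_ineq2[of z 1] by simp
      have big: "cmod z > 32 * C\<^sup>2 + cmod l + 1" using zr r by (simp add: R_def)
      have "C\<^sup>2 \<ge> 1" using C by simp
      then have z1': "cmod (z - 1) > 0" "cmod (z - 1) \<ge> cmod l" using z1 big norm_ge_zero[of l] by linarith+
      then have "z \<noteq> 1" by auto
      define u where "u = l / (z - 1)"
      have u: "cmod u \<le> 1" using z1' by (simp add: u_def norm_divide)
      have T: "renorm d l x = Fin ((1 + u) ^ d)" using Fin \<open>z \<noteq> 1\<close> by (simp add: renorm_Fin u_def)
      show ?thesis
      proof (cases "(1 + u) ^ d = 1")
        case True
        then show ?thesis using x T by simp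
      next
        case False
        define v where "v = l / ((1 + u) ^ d - 1)"
        have y: "y = Fin ((1 + v) ^ d)" using x T False by (simp add: renorm_Fin v_def)
        have pos: "cmod ((1 + u) ^ d - 1) > 0" using False by simp
        have "cmod ((1 + u) ^ d - 1) \<le> (2 ^ d - 1) * cmod u" by (rule norm_one_plus_power_minus_one[OF u])
        also have "\<dots> \<le> C * cmod u" by (intro mult_right_mono) (simp_all add: C_def)
        finally have le: "cmod ((1 + u) ^ d - 1) \<le> C * cmod u" .
        have "cmod (z - 1) / C = cmod l / (C * cmod u)"
          using C z1' assms(1) by (simp add: u_def norm_divide)
        also have "\<dots> \<le> cmod v" unfolding v_def norm_divide
          using le pos C z1' assms(1)
          by (intro divide_left_mono mult_pos_pos) (auto simp: u_def)
        finally have v: "cmod (z - 1) / C \<le> cmod v" .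
        have "cmod z / (2 * C) \<le> (cmod z - 1) / C - 1"
        proof -
          have "32 * C \<le> 32 * C\<^sup>2" using C by (simp add: power2_eq_square)
          then have "cmod z \<ge> 32 * C" using big norm_ge_zero[of l] by linarith
          then have "cmod z \<ge> 2 + 2 * C" using C by linarith
          then show ?thesis using C by (simp add: field_simps)
        qed
        also have "\<dots> \<le> cmod (z - 1) / C - 1" using z1 C by (simp add: divide_right_mono)
        also have "\<dots> \<le> cmod v - 1" using v by simp
        also have "\<dots> \<le> cmod (1 + v)" using norm_triangle_ineq2[of v "-1"] by (simp add: add.commute)
        finally have w: "cmod z / (2 * C) \<le> cmod (1 + v)" .
        have "32 * C\<^sup>2 \<ge> 32 * C" using C by (simp add: power2_eq_square)
        then have "cmod z \<ge> 2 * C" using big C norm_ge_zero[of l] by linarith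
        then have "1 \<le> cmod z / (2 * C)" using C by (simp add: field_simps)
        then have one: "1 \<le> cmod (1 + v)" using w by linarith
        have zpos: "cmod z > 0" using big norm_ge_zero[of l] by (smt (verit) zero_le_power2)
        have "cmod z > 8 * C\<^sup>2" using big norm_ge_zero[of l] \<open>C\<^sup>2 \<ge> 1\<close> by linarith
        then have "8 * C\<^sup>2 * cmod z < cmod z * cmod z" using zpos by (intro mult_strict_right_mono)
        then have "2 * cmod z < (cmod z / (2 * C))\<^sup>2"
          using C by (simp add: power_divide power_mult_distrib field_simps power2_eq_square)
        also have "\<dots> \<le> (cmod (1 + v))\<^sup>2" using w zpos C by (intro power_mono) auto
        also have "\<dots> \<le> cmod (1 + v) ^ d" using one assms(2) by (intro power_increasing) auto
        finally show ?thesis using zr y by (simp add: norm_power)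
      qed
    qed (use x in simp)
  qed
qed

lemma affine_power_outer_disc:
  assumes "c \<noteq> 0" "d \<ge> 2"
  obtains R where "R > 0" "\<And>r. r \<ge> R \<Longrightarrow> affine_power d c ` outer_disc r \<subseteq> outer_disc (2 * r)"
proof
  define k where "k = cmod c"
  have k: "k > 0" using assms by (simp add: k_def)
  define R where "R = 2 * (1 + k) / k + 8 / k\<^sup>2 + 2 / k"
  show "R > 0" unfolding R_def using k by (intro add_pos_pos divide_pos_pos) auto
  fix r assume r: "R \<le> r"
  show "affine_power d c ` outer_disc r \<subseteq> outer_disc (2 * r)"
  proof
    fix y assume "y \<in> affine_power d c ` outer_disc r"
    then obtain x where x: "x \<in> outer_disc r" "y = affine_power d c x" by auto
    show "y \<in> outer_disc (2 * r)"
    proof (cases x)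
      case (Fin z)
      have zr: "cmod z > r" using x Fin by simp
      have pos: "2 * (1 + k) / k > 0" "8 / k\<^sup>2 > 0" "2 / k > 0" using k by auto
      have z: "cmod z > 2 * (1 + k) / k" "cmod z > 8 / k\<^sup>2" "cmod z > 2 / k"
        using zr r pos unfolding R_def by linarith+
      have z': "k * cmod z > 2 * (1 + k)" "k\<^sup>2 * cmod z > 8" "k * cmod z > 2"
        using z k by (simp_all add: field_simps)
      have zpos: "cmod z > 0" using z(3) pos(3) by linarith
      have "k * cmod z = cmod ((1 + c * (z - 1)) - (1 - c))" by (simp add: k_def norm_mult algebra_simps)
      also have "\<dots> \<le> cmod (1 + c * (z - 1)) + cmod (1 - c)" by (rule norm_triangle_ineq4)
      finally have w: "k * cmod z / 2 \<le> cmod (1 + c * (z - 1))"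
        using z'(1) norm_triangle_ineq4[of 1 c] unfolding k_def by simp
      have one: "1 \<le> cmod (1 + c * (z - 1))" using w z'(3) by linarith
      have "2 * cmod z < k\<^sup>2 * cmod z * cmod z / 4" using z'(2) zpos by simp
      also have "\<dots> = (k * cmod z / 2)\<^sup>2" by (simp add: power2_eq_square)
      also have "\<dots> \<le> (cmod (1 + c * (z - 1)))\<^sup>2" using w k zpos by (intro power_mono) auto
      also have "\<dots> \<le> cmod (1 + c * (z - 1)) ^ d" using one assms(2) by (intro power_increasing) auto
      finally show ?thesis using zr Fin x by (simp add: norm_power)
    qed (use x in simp)
  qed
qed

section \<open>Orbits of real maps\<close>

lemma basin_backward: "f x \<in> basin f N \<Longrightarrow> x \<in> basin f N"
  by (auto simp: basin_def funpow_Suc_right intro: exI[of _ "Suc _"] simp del: funpow.simps)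

lemma subset_basin: "N \<subseteq> basin f N"
proof
  fix x assume "x \<in> N"
  then have "(f ^^ 0) x \<in> N" by simp
  then show "x \<in> basin f N" unfolding basin_def by blast
qed

lemma fixed_point_not_in_basin:
  fixes f :: "'a \<Rightarrow> 'a :: metric_space"
  assumes "uniform_limit N (\<lambda>n. f ^^ n) (\<lambda>_. a) sequentially" "f x = x" "x \<noteq> a"
  shows "x \<notin> basin f N"
proof
  assume "x \<in> basin f N"
  from basin_tendsto[OF assms(1) this] have "(\<lambda>n. (f ^^ n) x) \<longlonglongrightarrow> a" .
  moreover have "(f ^^ n) x = x" for n by (induction n) (simp_all add: assms)
  ultimately show False using assms(3) by (simp add: LIMSEQ_const_iff)
qed

text \<open>
  A bounded monotone orbit converges to a fixed point, and \<open>g\<close> has none in the interval. So every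
  orbit leaves the interval, and the membership in \<open>Q\<close> that it then acquires is pulled back along it.
\<close>

lemma increasing_orbit_enters:
  fixes g :: "real \<Rightarrow> real"
  assumes cont: "continuous_on {a..b} g" and up: "\<And>w. w \<in> {a..b} \<Longrightarrow> w < g w"
    and pull: "\<And>w. w \<in> {a..b} \<Longrightarrow> g w \<in> Q \<Longrightarrow> w \<in> Q"
    and enter: "\<And>w. w \<in> {a..b} \<Longrightarrow> b < g w \<Longrightarrow> w \<in> Q"
    and w: "w \<in> {a..b}"
  shows "w \<in> Q"
proof (rule ccontr)
  assume no: "w \<notin> Q"
  have orbit: "(g ^^ n) w \<in> {a..b} - Q" for n
  proof (induction n)
    case (Suc n)
    then show ?case using up[of "(g ^^ n) w"] pull[of "(g ^^ n) w"] enter[of "(g ^^ n) w"] by force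
  qed (use w no in auto)
  have "incseq (\<lambda>n. (g ^^ n) w)" using orbit up by (intro incseq_SucI) (force intro: less_imp_le)
  moreover have "\<forall>n. (g ^^ n) w \<le> b" using orbit by auto
  ultimately obtain L where L: "(\<lambda>n. (g ^^ n) w) \<longlonglongrightarrow> L" using incseq_convergent by blast
  have "L \<in> {a..b}" using closed_sequentially[OF closed_atLeastAtMost _ L] orbit by blast
  have "(\<lambda>n. g ((g ^^ n) w)) \<longlonglongrightarrow> g L"
    using continuous_on_tendsto_compose[OF cont L \<open>L \<in> {a..b}\<close>] orbit by simp
  moreover have "(\<lambda>n. g ((g ^^ n) w)) \<longlonglongrightarrow> L" using LIMSEQ_Suc[OF L] by simp
  ultimately have "g L = L" by (rule LIMSEQ_unique)
  with up[OF \<open>L \<in> {a..b}\<close>] show False by simp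
qed

lemma decreasing_orbit_enters:
  fixes g :: "real \<Rightarrow> real"
  assumes cont: "continuous_on {a..b} g" and down: "\<And>w. w \<in> {a..b} \<Longrightarrow> g w < w"
    and pull: "\<And>w. w \<in> {a..b} \<Longrightarrow> g w \<in> Q \<Longrightarrow> w \<in> Q"
    and enter: "\<And>w. w \<in> {a..b} \<Longrightarrow> g w < a \<Longrightarrow> w \<in> Q"
    and w: "w \<in> {a..b}"
  shows "w \<in> Q"
proof -
  have "- w \<in> uminus ` Q"
  proof (rule increasing_orbit_enters[of "-b" "-a" "\<lambda>w. - g (- w)"])
    show "continuous_on {- b..- a} (\<lambda>w. - g (- w))"
      by (intro continuous_intros continuous_on_compose2[OF cont]) auto
    show "v < - g (- v)" if "v \<in> {- b..- a}" for v using down[of "- v"] that by auto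
    show "v \<in> uminus ` Q" if "v \<in> {- b..- a}" "- g (- v) \<in> uminus ` Q" for v
      using pull[of "- v"] that by (auto intro!: image_eqI[of _ _ "- v"])
    show "v \<in> uminus ` Q" if "v \<in> {- b..- a}" "- a < - g (- v)" for v
      using enter[of "- v"] that by (auto intro!: image_eqI[of _ _ "- v"])
    show "- w \<in> {- b..- a}" using w by auto
  qed
  then show ?thesis by auto
qed

section \<open>Geometric sums\<close>

lemma sum_powers_strict_mono:
  fixes s t :: real
  assumes "0 \<le> s" "s < t" "2 \<le> d"
  shows "(\<Sum>k<d. s ^ k) < (\<Sum>k<d. t ^ k)"
proof (rule sum_strict_mono_ex1)
  show "\<forall>k\<in>{..<d}. s ^ k \<le> t ^ k" using assms by (auto intro: power_mono)
  show "\<exists>k\<in>{..<d}. s ^ k < t ^ k" using assms by (intro bexI[of _ 1]) auto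
qed simp

lemma sum_powers_minus_even:
  "(\<Sum>k<2 * m. (- t) ^ k) = - ((t - 1) * (\<Sum>j<m. t ^ (2 * j)))" for t :: real
  by (induction m) (simp_all add: algebra_simps)

lemma sum_powers_minus_odd:
  "(\<Sum>k<Suc (2 * m). (- t) ^ k) = 1 + t * (t - 1) * (\<Sum>j<m. t ^ (2 * j))" for t :: real
  by (induction m) (simp_all add: algebra_simps)

lemma sum_even_powers_strict_mono:
  fixes t u :: real
  assumes "1 \<le> t" "t < u" "m > 0"
  shows "(t - 1) * (\<Sum>j<m. t ^ (2 * j)) < (u - 1) * (\<Sum>j<m. u ^ (2 * j))"
proof -
  have "(\<Sum>j<m. t ^ (2 * j)) \<le> (\<Sum>j<m. u ^ (2 * j))" using assms by (intro sum_mono power_mono) auto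
  moreover have "(\<Sum>j<m. u ^ (2 * j)) > 0" using assms by (intro sum_pos) auto
  ultimately have "(t - 1) * (\<Sum>j<m. t ^ (2 * j)) \<le> (t - 1) * (\<Sum>j<m. u ^ (2 * j))"
    "(t - 1) * (\<Sum>j<m. u ^ (2 * j)) < (u - 1) * (\<Sum>j<m. u ^ (2 * j))"
    using assms by (auto intro: mult_left_mono mult_strict_right_mono)
  then show ?thesis by linarith
qed

section \<open>Nonzero real parameters\<close>

text \<open>
  The last assumption makes \<^term>\<open>outer_disc R\<close> a trapping neighbourhood of \<open>\<infinity>\<close>; such an \<open>R\<close> always
  exists, by \<open>renorm_renorm_outer_disc\<close>.
\<close>

locale real_parameter =
  fixes d :: nat and l R :: real
  assumes d: "2 \<le> d" and l: "l \<noteq> 0" and R: "0 < R"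
    and escape: "\<And>r. R \<le> r \<Longrightarrow>
      (renorm d (of_real l) \<circ> renorm d (of_real l)) ` outer_disc r \<subseteq> outer_disc (2 * r)"
begin

abbreviation T where "T \<equiv> renorm d (of_real l)"
abbreviation F where "F \<equiv> T \<circ> T"
abbreviation A where "A \<equiv> basin F (outer_disc R)"
abbreviation pt :: "real \<Rightarrow> riemann_sphere" where "pt w \<equiv> Fin (of_real (1 + w))"

text \<open>The map in the real coordinate \<open>w = z - 1\<close>.\<close>

definition tau :: "real \<Rightarrow> real" where "tau w = (1 + l / w) ^ d - 1"

lemma T_pt: "w \<noteq> 0 \<Longrightarrow> T (pt w) = pt (tau w)"
  by (simp add: renorm_Fin tau_def)

text \<open>The geometric sum behind all comparisons of \<^term>\<open>tau (tau w)\<close> with \<open>w\<close>.\<close>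

lemma tau_mult: "w \<noteq> 0 \<Longrightarrow> w * tau w = l * (\<Sum>k<d. (1 + l / w) ^ k)"
  by (simp add: tau_def power_diff_1_eq)

lemma continuous_on_tau: "0 \<notin> S \<Longrightarrow> continuous_on S tau"
  unfolding tau_def by (intro continuous_intros) auto

lemma continuous_on_tau_tau:
  "0 \<notin> S \<Longrightarrow> (\<And>w. w \<in> S \<Longrightarrow> tau w \<noteq> 0) \<Longrightarrow> continuous_on S (\<lambda>w. tau (tau w))"
  by (rule continuous_on_compose2[OF continuous_on_tau[of "tau ` S"] continuous_on_tau]) auto

lemma continuous_on_T: "continuous_on UNIV T" and continuous_on_F: "continuous_on UNIV F"
proof -
  show T: "continuous_on UNIV T" using d l by (intro continuous_on_renorm) auto
  show "continuous_on UNIV F"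
    by (rule continuous_on_compose[OF T continuous_on_subset[OF T subset_UNIV]])
qed

lemma iterates_tend_to_Infty: "uniform_limit (outer_disc R) (\<lambda>n. F ^^ n) (\<lambda>_. Infty) sequentially"
  by (rule uniform_limit_outer_disc[OF R escape])

lemma pt_far_in_basin: "R + 1 < \<bar>w\<bar> \<Longrightarrow> pt w \<in> A"
proof -
  assume "R + 1 < \<bar>w\<bar>"
  then have "R < \<bar>1 + w\<bar>" by linarith
  then have "pt w \<in> outer_disc R" unfolding Fin_in_outer_disc norm_of_real .
  then show ?thesis by (rule subsetD[OF subset_basin])
qed

text \<open>This holds because \<^term>\<open>T\<close> maps \<open>1\<close>, which has coordinate \<open>0\<close>, to \<open>\<infinity>\<close>.\<close>

lemma pt_near_0_in_preimage: "\<exists>e>0. \<forall>w. \<bar>w\<bar> < e \<longrightarrow> T (pt w) \<in> A"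
proof -
  have "continuous_on UNIV (\<lambda>w. T (pt w))"
    by (intro continuous_on_compose2[OF continuous_on_T] continuous_on_compose2[OF continuous_on_Fin[of UNIV]]
        continuous_intros) auto
  then have "open ((\<lambda>w. T (pt w)) -` A)"
    by (intro open_vimage open_basin continuous_on_F open_outer_disc)
  moreover have "Infty \<in> A" by (rule subsetD[OF subset_basin]) simp
  then have "0 \<in> (\<lambda>w. T (pt w)) -` A" by simp
  ultimately obtain e where e: "e > 0" "ball 0 e \<subseteq> (\<lambda>w. T (pt w)) -` A" by (rule openE)
  have "T (pt w) \<in> A" if "\<bar>w\<bar> < e" for w using subsetD[OF e(2), of w] that by simp
  with e(1) show ?thesis by blast
qed

lemma basin_pull: "w \<noteq> 0 \<Longrightarrow> tau w \<noteq> 0 \<Longrightarrow> pt (tau (tau w)) \<in> A \<Longrightarrow> pt w \<in> A"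
  by (rule basin_backward) (simp add: T_pt del: of_real_add)

lemma preimage_pull:
  assumes "w \<noteq> 0" "tau w \<noteq> 0" "T (pt (tau (tau w))) \<in> A"
  shows "T (pt w) \<in> A"
proof (rule basin_backward)
  show "F (T (pt w)) \<in> A" using assms by (simp add: T_pt del: of_real_add)
qed

lemma basin_if_image_in_preimage: "w \<noteq> 0 \<Longrightarrow> T (pt (tau w)) \<in> A \<Longrightarrow> pt w \<in> A"
  by (rule basin_backward) (simp add: T_pt del: of_real_add)

text \<open>
  The condition \<^prop>\<open>T (pt t) \<in> A\<close> says that \<^term>\<open>pt t\<close> is attracted to \<open>1\<close>, so it puts the point in the
  Fatou set and outside \<^term>\<open>A\<close>.
\<close>

lemma not_sierpinski_carpet_at_cycle:
  assumes p: "p \<noteq> 0" "tau p \<noteq> 0" "tau (tau p) = p"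
    and c1: "c1 \<noteq> p" "\<And>t. t \<in> closed_segment p c1 \<Longrightarrow> t \<noteq> p \<Longrightarrow> pt t \<in> A"
    and c2: "c2 \<noteq> p" "\<And>t. t \<in> closed_segment p c2 \<Longrightarrow> t \<noteq> p \<Longrightarrow> T (pt t) \<in> A"
  shows "\<not> sierpinski_carpet (julia_set F)"
proof (rule not_sierpinski_carpet_julia_set[OF continuous_on_F open_outer_disc Infty_in_outer_disc iterates_tend_to_Infty,
      where x = "1 + p" and ?c1.0 = "1 + c1" and ?c2.0 = "1 + c2"])
  have "F (pt p) = pt p" using p by (simp add: T_pt del: of_real_add)
  then show "pt p \<notin> A" by (rule fixed_point_not_in_basin[OF iterates_tend_to_Infty]) simp
  have seg: "t - 1 \<in> closed_segment p c" if "t \<in> closed_segment (1 + p) (1 + c)" for t c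
    using that by (auto simp: closed_segment_eq_real_ivl split: if_splits)
  show "Fin (of_real t) \<in> A" if "t \<in> closed_segment (1 + p) (1 + c1)" "t \<noteq> 1 + p" for t
    using c1(2)[OF seg[OF that(1)]] that(2) by simp
  show "Fin (of_real t) \<in> fatou_set F - A" if "t \<in> closed_segment (1 + p) (1 + c2)" "t \<noteq> 1 + p" for t
  proof -
    have "T (Fin (of_real t)) \<in> A" using c2(2)[OF seg[OF that(1)]] that(2) by simp
    then show ?thesis by (rule preimage_basin[OF continuous_on_T open_outer_disc iterates_tend_to_Infty, rotated]) simp
  qed
qed (use c1 c2 in auto)

text \<open>
  The quotient of \<^term>\<open>tau (tau w)\<close> by \<open>w\<close> is the quotient of the values of \<open>w \<cdot> tau w\<close> at \<^term>\<open>tau w\<close> and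
  at \<open>w\<close>. Where \<open>w \<cdot> tau w\<close> strictly decreases, \<^term>\<open>tau\<close> therefore expands logarithmic distances, and
  a positive fixed point repels.
\<close>

lemma tau_tau_greater:
  assumes "0 < tau w" "tau w * tau (tau w) > w * tau w"
  shows "w < tau (tau w)"
  using assms by (simp add: mult.commute[of w])

lemma tau_tau_less:
  assumes "0 < tau w" "tau w * tau (tau w) < w * tau w"
  shows "tau (tau w) < w"
  using assms by (simp add: mult.commute[of w])

text \<open>
  On \<open>w > 0\<close> both \<^term>\<open>tau\<close> and \<open>w \<cdot> tau w\<close> strictly decrease. So \<^term>\<open>tau\<close> has a repelling fixed point
  \<open>p\<close>; everything to its right escapes, and \<^term>\<open>tau\<close> exchanges the two sides of \<open>p\<close>.
\<close>

lemma not_sierpinski_carpet_positive: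
  assumes "l > 0"
  shows "\<not> sierpinski_carpet (julia_set F)"
proof -
  have pos: "tau w > 0" if "w > 0" for w
    unfolding tau_def using \<open>l > 0\<close> that d by (simp add: one_less_power)
  have anti: "tau w < tau v" if "0 < v" "v < w" for v w
    unfolding tau_def using \<open>l > 0\<close> that d
    by (simp add: power_strict_mono divide_strict_left_mono)
  have phi: "w * tau w < v * tau v" if "0 < v" "v < w" for v w
  proof -
    have "(\<Sum>k<d. (1 + l / w) ^ k) < (\<Sum>k<d. (1 + l / v) ^ k)"
      using \<open>l > 0\<close> that d by (intro sum_powers_strict_mono) (auto simp: divide_strict_left_mono)
    then show ?thesis using tau_mult[of v] tau_mult[of w] \<open>l > 0\<close> that by simp
  qed
  \<comment> \<open>At \<open>sqrt l\<close>, where \<open>l / w = w\<close>, the function \<open>tau\<close> is not yet below the diagonal.\<close>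
  define a where "a = sqrt l"
  have a: "a > 0" "l / a = a" using \<open>l > 0\<close> by (simp_all add: a_def real_div_sqrt)
  have "(1 + a) ^ 1 \<le> (1 + a) ^ d" using a d by (intro power_increasing) auto
  then have a1: "tau a \<ge> a" unfolding tau_def a(2) by simp
  define b where "b = a + tau a"
  have "a < b" using pos[OF a(1)] by (simp add: b_def)
  have b1: "tau b \<le> b" using anti[OF a(1) \<open>a < b\<close>] a by (simp add: b_def)
  have "continuous_on {a..b} (\<lambda>w. w - tau w)" using a by (intro continuous_intros continuous_on_tau) auto
  then obtain p where p: "a \<le> p" "p \<le> b" "p - tau p = 0"
    using IVT'[of "\<lambda>w. w - tau w" a 0 b] a1 b1 \<open>a < b\<close> by auto
  have "p > 0" using a p by simp
  have "tau p = p" using p by simp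
  have up: "w < tau (tau w)" if "p < w" for w
  proof (rule tau_tau_greater)
    have "w > 0" using that \<open>p > 0\<close> by simp
    then show "0 < tau w" by (rule pos)
    have "tau w < w" using anti[OF \<open>p > 0\<close> that] that \<open>tau p = p\<close> by simp
    then show "w * tau w < tau w * tau (tau w)" by (rule phi[OF \<open>0 < tau w\<close>])
  qed
  have right: "pt w \<in> A" if "p < w" for w
  proof -
    define M where "M = max w (R + 1)"
    have "w \<in> {w. pt w \<in> A}"
    proof (rule increasing_orbit_enters[of w M "\<lambda>w. tau (tau w)"])
      show "continuous_on {w..M} (\<lambda>w. tau (tau w))"
      proof (rule continuous_on_tau_tau)
        show "0 \<notin> {w..M}" using that \<open>p > 0\<close> by simp
        show "tau v \<noteq> 0" if "v \<in> {w..M}" for v using pos[of v] that \<open>p < w\<close> \<open>p > 0\<close> by auto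
      qed
      fix v assume v: "v \<in> {w..M}"
      then have "v > p" "v > 0" using that \<open>p > 0\<close> by auto
      then show "v < tau (tau v)" using up by simp
      note nz = \<open>v > 0\<close>[THEN less_imp_neq, THEN not_sym] pos[OF \<open>v > 0\<close>, THEN less_imp_neq, THEN not_sym]
      show "v \<in> {w. pt w \<in> A}" if "tau (tau v) \<in> {w. pt w \<in> A}"
        using basin_pull[OF nz] that by blast
      show "v \<in> {w. pt w \<in> A}" if "M < tau (tau v)"
        using basin_pull[OF nz pt_far_in_basin] that by (auto simp: M_def)
    qed (simp add: M_def)
    then show ?thesis by simp
  qed
  have left: "T (pt w) \<in> A" if "0 < w" "w < p" for w
  proof -
    have "p < tau w" using anti[OF that] \<open>tau p = p\<close> by simp
    then show ?thesis using right that by (simp add: T_pt del: of_real_add)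
  qed
  show ?thesis
  proof (rule not_sierpinski_carpet_at_cycle[of p "p + 1" "p / 2"])
    show "pt t \<in> A" if "t \<in> closed_segment p (p + 1)" "t \<noteq> p" for t
      using that by (intro right) (auto simp: closed_segment_eq_real_ivl)
    show "T (pt t) \<in> A" if "t \<in> closed_segment p (p / 2)" "t \<noteq> p" for t
      using that \<open>p > 0\<close> by (intro left) (auto simp: closed_segment_eq_real_ivl split: if_splits)
  qed (use \<open>p > 0\<close> \<open>tau p = p\<close> in auto)
qed

text \<open>
  With \<open>\<sigma> = 1 + l / w > 1\<close> and \<open>s = 1 + l / tau w\<close> in \<open>[0, 1)\<close>, the geometric sum at \<open>\<sigma>\<close> exceeds \<open>d\<close> and the
  one at \<open>s\<close> does not reach it.
\<close>

lemma tau_tau_negative: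
  assumes "l < 0" "-1 \<le> w" "w < 0"
  shows "tau w > 0" "w < tau (tau w)" "tau (tau w) < 0"
proof -
  define \<sigma> where "\<sigma> = 1 + l / w"
  have \<sigma>: "\<sigma> > 1" using assms by (simp add: \<sigma>_def divide_neg_neg)
  have S: "(\<Sum>k<d. \<sigma> ^ k) > d" using sum_powers_strict_mono[of 1 \<sigma> d] \<sigma> d by simp
  have "- l * 2 \<le> - l * (\<Sum>k<d. \<sigma> ^ k)" using S d assms(1) by (intro mult_left_mono) auto
  also have "\<dots> = - w * tau w" using tau_mult[of w] assms(3) by (simp add: \<sigma>_def)
  finally have bound: "- l * 2 \<le> - w * tau w" .
  then have "- w * tau w > 0" using assms(1) by linarith
  then show pos: "tau w > 0" using assms(3) by (simp add: zero_less_mult_iff mult_less_0_iff)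
  have "- w * tau w \<le> 1 * tau w" using assms pos by (intro mult_right_mono) auto
  with bound have tl: "- l * 2 \<le> tau w" by simp
  define s where "s = 1 + l / tau w"
  have s: "0 \<le> s" "s < 1" using tl assms(1) pos by (simp_all add: s_def field_simps divide_neg_pos)
  have S': "(\<Sum>k<d. s ^ k) < d" using sum_powers_strict_mono[of s 1 d] s d by simp
  have "l * (\<Sum>k<d. \<sigma> ^ k) < l * (\<Sum>k<d. s ^ k)" using S S' assms(1) by (intro mult_strict_left_mono_neg) auto
  then show "w < tau (tau w)"
    using tau_mult[of w] tau_mult[of "tau w"] assms(3) pos by (intro tau_tau_greater) (simp_all add: \<sigma>_def s_def)
  have "s ^ d < 1" using s d by (simp add: power_Suc_less_one power_less_one_iff)
  then show "tau (tau w) < 0" by (simp add: tau_def[of "tau w"] s_def)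
qed

text \<open>
  The interval \<open>[0, 1]\<close> of the original coordinate lies in the basin of \<open>1\<close>: orbits in it increase
  towards \<open>1\<close>.
\<close>

lemma negative_unit_interval_in_preimage:
  assumes "l < 0" "-1 \<le> w" "w \<le> 0"
  shows "T (pt w) \<in> A"
proof -
  obtain e where e: "e > 0" "\<And>w. \<bar>w\<bar> < e \<Longrightarrow> T (pt w) \<in> A" using pt_near_0_in_preimage by blast
  show ?thesis
  proof (cases "\<bar>w\<bar> < e")
    case False
    have "w \<in> {w. T (pt w) \<in> A}"
    proof (rule increasing_orbit_enters[of "-1" "- e / 2" "\<lambda>w. tau (tau w)"])
      show "continuous_on {-1..- e / 2} (\<lambda>w. tau (tau w))"
        using e(1) tau_tau_negative(1)[OF assms(1)] by (intro continuous_on_tau_tau) force+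
      fix v assume "v \<in> {-1..- e / 2}"
      then have v: "-1 \<le> v" "v < 0" using e(1) by auto
      note tt = tau_tau_negative[OF assms(1) v]
      show "v < tau (tau v)" by (rule tt)
      show "v \<in> {w. T (pt w) \<in> A}" if "tau (tau v) \<in> {w. T (pt w) \<in> A}"
        using preimage_pull[of v] v tt that by auto
      show "v \<in> {w. T (pt w) \<in> A}" if "- e / 2 < tau (tau v)"
        using preimage_pull[of v] v tt that e by auto
    qed (use False assms e(1) in auto)
    then show ?thesis by simp
  qed (rule e)
qed

text \<open>
  The repelling fixed point \<open>p\<close> of \<^term>\<open>tau\<close> now lies in \<open>(0, B)\<close> with \<open>B = - l / 2\<close>, where
  \<open>1 + l / w < - 1\<close> and \<^term>\<open>tau\<close> is positive and decreasing with \<open>tau B = 0\<close>. Orbits starting in \<open>(0, p)\<close>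
  decrease. They approach the coordinate \<open>0\<close> of the point \<open>1\<close> or they overshoot it; overshooting means that
  \<^term>\<open>tau\<close> takes a value beyond \<open>B\<close>, and then the next value lies in \<open>[-1, 0]\<close>, which is attracted to \<open>1\<close>
  as well.
\<close>

lemma not_sierpinski_carpet_negative_even:
  assumes "l < 0" "even d"
  shows "\<not> sierpinski_carpet (julia_set F)"
proof -
  obtain m where m: "d = 2 * m" using assms(2) by blast
  then have "m > 0" using d by simp
  define B where "B = - l / 2"
  have "B > 0" using assms by (simp add: B_def)
  have tau: "tau w = (- l / w - 1) ^ d - 1" for w
  proof -
    have eq: "- l / w - 1 = - (1 + l / w)" by simp
    show ?thesis unfolding tau_def eq by (simp only: power_minus_even[OF assms(2)])
  qed
  have t: "1 \<le> - l / w - 1" if "0 < w" "w \<le> B" for w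
    using that assms(1) by (simp add: B_def field_simps)
  have mono: "- l / w - 1 < - l / v - 1" if "0 < v" "v < w" for v w
    using that assms(1) by (simp add: field_simps mult_strict_right_mono)
  have anti: "tau w < tau v" if "0 < v" "v < w" "w \<le> B" for v w
    unfolding tau using mono[OF that(1,2)] t[of w] that d by (simp add: power_strict_mono)
  have "tau B = 0" using assms by (simp add: tau B_def)
  then have pos: "tau w > 0" if "0 < w" "w < B" for w using anti[OF that] by simp
  have phi: "w * tau w < v * tau v" if "0 < v" "v < w" "w \<le> B" for v w
  proof -
    have eq: "u * tau u = - l * ((- l / u - 1 - 1) * (\<Sum>j<m. (- l / u - 1) ^ (2 * j)))" if "u > 0" for u
    proof -
      have "1 + l / u = - (- l / u - 1)" by simp
      then show ?thesis using tau_mult[of u] that sum_powers_minus_even[where t = "- l / u - 1" and m = m] m by simp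
    qed
    have "(- l / w - 1 - 1) * (\<Sum>j<m. (- l / w - 1) ^ (2 * j)) < (- l / v - 1 - 1) * (\<Sum>j<m. (- l / v - 1) ^ (2 * j))"
      using t[of w] mono[OF that(1,2)] that \<open>m > 0\<close> by (intro sum_even_powers_strict_mono) auto
    then show ?thesis using eq[of v] eq[of w] that assms(1) by simp
  qed
  have beyond: "tau v \<le> 0" "-1 \<le> tau v" if "B \<le> v" for v
  proof -
    have "v > 0" using that \<open>B > 0\<close> by simp
    have "- l \<le> 2 * v" using that by (simp add: B_def)
    then have "\<bar>1 + l / v\<bar> \<le> 1" using \<open>v > 0\<close> assms(1) by (auto simp: abs_le_iff field_simps)
    then have "\<bar>1 + l / v\<bar> ^ d \<le> 1" by (simp add: power_le_one)
    then show "tau v \<le> 0" "-1 \<le> tau v" using assms(2)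
      by (simp_all add: tau_def power_even_abs add_increasing zero_le_even_power)
  qed
  \<comment> \<open>Here \<open>1 + l / a \<le> - 3\<close>, so \<open>tau a\<close> is at least \<open>8\<close>, which exceeds \<open>a\<close>.\<close>
  define a where "a = min (- l / 4) 1"
  have a: "a > 0" "a < B" "a \<le> 1" using assms(1) by (auto simp: a_def B_def)
  have "a \<le> - l / 4" by (simp add: a_def)
  then have "3 \<le> - l / a - 1" using a by (simp add: field_simps)
  then have "3 ^ d \<le> (- l / a - 1) ^ d" by (intro power_mono) auto
  moreover have "(3::real) ^ 2 \<le> 3 ^ d" using d by (intro power_increasing) auto
  ultimately have a1: "a \<le> tau a" using a by (simp add: tau)
  have "continuous_on {a..B} (\<lambda>w. w - tau w)" using a by (intro continuous_intros continuous_on_tau) auto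
  then obtain p where p: "a \<le> p" "p \<le> B" "p - tau p = 0"
    using IVT'[of "\<lambda>w. w - tau w" a 0 B] a1 a \<open>tau B = 0\<close> \<open>B > 0\<close> by auto
  have "p > 0" "tau p = p" using a p by simp_all
  then have "p < B" using p(2) \<open>tau B = 0\<close> by (cases "p = B") auto
  obtain e where e: "e > 0" "\<And>w. \<bar>w\<bar> < e \<Longrightarrow> T (pt w) \<in> A" using pt_near_0_in_preimage by blast
  have left: "T (pt w) \<in> A" if "0 < w" "w < p" for w
  proof (cases "w < e")
    case False
    have "w \<in> {w. T (pt w) \<in> A}"
    proof (rule decreasing_orbit_enters[of e w "\<lambda>w. tau (tau w)"])
      have tw: "tau v > p" if "v \<in> {e..w}" for v
        using anti[of v p] that e(1) \<open>w < p\<close> p(2) \<open>tau p = p\<close> by auto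
      show "continuous_on {e..w} (\<lambda>w. tau (tau w))"
        using e(1) tw \<open>p > 0\<close> by (intro continuous_on_tau_tau) force+
      fix v assume v: "v \<in> {e..w}"
      then have v': "0 < v" "v < p" using e(1) \<open>w < p\<close> by auto
      have nz: "v \<noteq> 0" "tau v \<noteq> 0" using v' tw[OF v] \<open>p > 0\<close> by auto
      show "tau (tau v) < v"
      proof (cases "tau v \<le> B")
        case True
        show ?thesis
          by (rule tau_tau_less) (use phi[of v "tau v"] tw[OF v] v' \<open>p > 0\<close> True in auto)
      next
        case False
        then show ?thesis using beyond(1)[of "tau v"] v' by simp
      qed
      show "v \<in> {w. T (pt w) \<in> A}" if "tau (tau v) \<in> {w. T (pt w) \<in> A}"
        using preimage_pull[OF nz] that by simp
      show "v \<in> {w. T (pt w) \<in> A}" if "tau (tau v) < e"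
      proof (cases "tau (tau v) > 0")
        case True
        then show ?thesis using preimage_pull[OF nz e(2)] that by simp
      next
        case False
        have "-1 \<le> tau (tau v)"
        proof (cases "tau v \<le> B")
          case True
          then have "tau (tau v) \<ge> tau B" using anti[of "tau v" B] tw[OF v] \<open>p > 0\<close> by (cases "tau v = B") auto
          then show ?thesis using \<open>tau B = 0\<close> by simp
        qed (use beyond(2)[of "tau v"] in simp)
        then show ?thesis using preimage_pull[OF nz negative_unit_interval_in_preimage[OF assms(1)]] False by simp
      qed
    qed (use False in auto)
    then show ?thesis by simp
  qed (use e that in auto)
  have right: "pt w \<in> A" if "p < w" "w < B" for w
  proof -
    have "tau w < p" "0 < tau w" using anti[of p w] pos[of w] that \<open>p > 0\<close> \<open>tau p = p\<close> by auto
    then show ?thesis using left basin_if_image_in_preimage[of w] that \<open>p > 0\<close> by auto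
  qed
  show ?thesis
  proof (rule not_sierpinski_carpet_at_cycle[of p "(p + B) / 2" "p / 2"])
    show "pt t \<in> A" if "t \<in> closed_segment p ((p + B) / 2)" "t \<noteq> p" for t
      using that \<open>p < B\<close> by (intro right) (auto simp: closed_segment_eq_real_ivl split: if_splits)
    show "T (pt t) \<in> A" if "t \<in> closed_segment p (p / 2)" "t \<noteq> p" for t
      using that \<open>p > 0\<close> by (intro left) (auto simp: closed_segment_eq_real_ivl split: if_splits)
  qed (use \<open>p > 0\<close> \<open>tau p = p\<close> \<open>p < B\<close> in auto)
qed

text \<open>
  Here \<^term>\<open>tau\<close> maps each half-line into the other one, so the fixed point \<open>q\<close> of \<open>tau \<circ> tau\<close> is sought
  on \<open>w < 0\<close>. For a negative \<open>w\<close> the inequality \<open>tau (tau w) \<le> w\<close> means \<open>N (1 + l / w) \<le> N (1 + l / tau w)\<close>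
  for the geometric sum \<open>N\<close>. The left side exceeds \<open>d\<close>, which forces \<open>1 + l / tau w < - 1\<close>, where \<open>N\<close>
  decreases. So when \<open>w\<close> moves further to the left, the left side falls and the right side grows (fact
  \<open>key\<close>). Hence orbits escape on the left of \<open>q\<close> and tend to \<open>0\<close> on its right.
\<close>

lemma not_sierpinski_carpet_negative_odd:
  assumes "l < 0" "odd d"
  shows "\<not> sierpinski_carpet (julia_set F)"
proof -
  obtain m where m: "d = Suc (2 * m)" using assms(2) by (auto elim: oddE)
  then have "m > 0" using d by simp
  define N where "N s = (\<Sum>k<d. s ^ k)" for s :: real
  have pos: "tau w > 0" and sigma: "1 + l / w > 1" if "w < 0" for w
  proof -
    show *: "1 + l / w > 1" using that assms by (simp add: divide_neg_neg)
    show "tau w > 0" using one_less_power[OF *, of d] d by (simp add: tau_def)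
  qed
  have neg: "tau w < 0" if "w > 0" for w
  proof (cases "1 + l / w \<ge> 0")
    case True
    have "1 + l / w < 1" using that assms by (simp add: divide_neg_pos)
    then have "(1 + l / w) ^ d < 1" using True d by (simp add: power_less_one_iff)
    then show ?thesis by (simp add: tau_def)
  next
    case False
    then have "(1 + l / w) ^ d < 0" using assms(2) by (simp add: power_less_zero_eq)
    then show ?thesis unfolding tau_def by linarith
  qed
  have quot: "l / w < l / v" if "w < v" "0 < w * v" for v w
    using that assms(1) by (simp add: divide_strict_left_mono_neg)
  have mono: "tau w < tau v" if "w < v" "v < 0" for v w
  proof -
    have "l / w < l / v" using that by (intro quot) (auto simp: mult_neg_neg)
    then show ?thesis unfolding tau_def using sigma[of w] that d by (simp add: power_strict_mono)
  qed
  have small: "N s \<le> d" if "-1 \<le> s" "s < 1" for s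
  proof (cases "0 \<le> s")
    case True
    then show ?thesis using sum_powers_strict_mono[of s 1 d] that d by (simp add: N_def)
  next
    case False
    have "N s = 1 + (- s) * ((- s) - 1) * (\<Sum>j<m. (- s) ^ (2 * j))"
      using sum_powers_minus_odd[of "- s" m] by (simp add: N_def m)
    moreover have "(- s) * ((- s) - 1) * (\<Sum>j<m. (- s) ^ (2 * j)) \<le> 0"
      using that False by (intro mult_nonpos_nonneg mult_nonneg_nonpos sum_nonneg) auto
    ultimately show ?thesis using d by simp
  qed
  have N_anti: "N t < N s" if "s < t" "t \<le> -1" for s t
  proof -
    have eq: "N u = 1 + (- u) * ((- u - 1) * (\<Sum>j<m. (- u) ^ (2 * j)))" for u
      using sum_powers_minus_odd[of "- u" m] by (simp add: N_def m mult.assoc)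
    have x1: "(- t - 1) * (\<Sum>j<m. (- t) ^ (2 * j)) < (- s - 1) * (\<Sum>j<m. (- s) ^ (2 * j))"
      using that \<open>m > 0\<close> by (intro sum_even_powers_strict_mono) auto
    have x2: "0 \<le> (- t - 1) * (\<Sum>j<m. (- t) ^ (2 * j))"
      using that by (intro mult_nonneg_nonneg sum_nonneg) auto
    have "(- t) * ((- t - 1) * (\<Sum>j<m. (- t) ^ (2 * j)))
        < (- s) * ((- s - 1) * (\<Sum>j<m. (- s) ^ (2 * j)))"
      by (rule mult_strict_mono[OF _ x1 _ x2]) (use that in auto)
    then show ?thesis unfolding eq[of t] eq[of s] by simp
  qed
  have mults: "w * tau w = l * N (1 + l / w)" "tau w * tau (tau w) = l * N (1 + l / tau w)" if "w < 0" for w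
    using tau_mult[of w] tau_mult[of "tau w"] that pos[OF that] by (simp_all add: N_def)
  have key: "tau (tau v) < v" if "v < w" "w < 0" "tau (tau w) \<le> w" for v w
  proof -
    have "v < 0" using that by simp
    have "tau w * tau (tau w) \<le> tau w * w" using that pos[of w] by (intro mult_left_mono) auto
    then have "l * N (1 + l / tau w) \<le> l * N (1 + l / w)" using mults[OF that(2)] by (simp add: mult.commute)
    then have N1: "N (1 + l / w) \<le> N (1 + l / tau w)" using assms(1) by simp
    have "real d < N (1 + l / w)"
      using sum_powers_strict_mono[of 1 "1 + l / w" d] sigma[OF that(2)] d by (simp add: N_def)
    then have "1 + l / tau w < -1"
      using N1 small[of "1 + l / tau w"] pos[OF that(2)] assms(1) by (force simp: divide_neg_pos)
    moreover have "l / tau v < l / tau w"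
      using mono[OF that(1,2)] pos[OF that(2)] pos[OF \<open>v < 0\<close>] by (intro quot) auto
    ultimately have N2: "N (1 + l / tau w) < N (1 + l / tau v)" by (intro N_anti) auto
    have "l / v < l / w" using that by (intro quot) (auto simp: mult_neg_neg)
    then have N3: "N (1 + l / v) < N (1 + l / w)"
      unfolding N_def using sigma[OF \<open>v < 0\<close>] d by (intro sum_powers_strict_mono) auto
    have "l * N (1 + l / tau v) < l * N (1 + l / v)"
      using N1 N2 N3 assms(1) by (intro mult_strict_left_mono_neg) auto
    then show ?thesis using mults[OF \<open>v < 0\<close>] by (intro tau_tau_less pos \<open>v < 0\<close>) simp
  qed
  \<comment> \<open>Far to the left the escape to \<open>\<infinity>\<close> shows that \<open>tau \<circ> tau\<close> is below the diagonal.\<close>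
  define a where "a = - R - 3"
  have a: "a < -1" "a < 0" using R by (simp_all add: a_def)
  have ga: "tau (tau a) \<le> a"
  proof -
    have "pt a \<in> outer_disc (R + 1)" unfolding Fin_in_outer_disc norm_of_real using R by (simp add: a_def)
    then have "F (pt a) \<in> outer_disc (2 * (R + 1))" using escape[of "R + 1"] by auto
    moreover have "F (pt a) = pt (tau (tau a))" using a pos[of a] by (simp add: T_pt del: of_real_add)
    ultimately have "pt (tau (tau a)) \<in> outer_disc (2 * (R + 1))" by (simp only:)
    then have "2 * (R + 1) < \<bar>1 + tau (tau a)\<bar>" unfolding Fin_in_outer_disc norm_of_real .
    then show ?thesis using neg[OF pos[OF a(2)]] R by (simp add: a_def)
  qed
  have cont: "continuous_on S (\<lambda>w. tau (tau w))" if "S \<subseteq> {..<0}" for S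
  proof (rule continuous_on_tau_tau)
    show "0 \<notin> S" using that by auto
    show "tau w \<noteq> 0" if "w \<in> S" for w using pos[of w] that \<open>S \<subseteq> {..<0}\<close> by auto
  qed
  have "continuous_on {a..-1} (\<lambda>w. tau (tau w) - w)" by (intro continuous_intros cont) auto
  then obtain q where q: "a \<le> q" "q \<le> -1" "tau (tau q) - q = 0"
    using IVT'[of "\<lambda>w. tau (tau w) - w" a 0 "-1"] ga a tau_tau_negative(2)[OF assms(1), of "-1"] by auto
  then have "q < 0" "tau (tau q) = q" by auto
  have left: "pt w \<in> A" if "w < q" for w
  proof -
    define M where "M = min w (- R - 2)"
    have "w \<in> {w. pt w \<in> A}"
    proof (rule decreasing_orbit_enters[of M w "\<lambda>w. tau (tau w)"])
      show "continuous_on {M..w} (\<lambda>w. tau (tau w))" using that \<open>q < 0\<close> by (intro cont) auto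
      fix v assume "v \<in> {M..w}"
      then have v: "v < q" "v < 0" using that \<open>q < 0\<close> by auto
      show "tau (tau v) < v" using key[OF v(1) \<open>q < 0\<close>] \<open>tau (tau q) = q\<close> by simp
      have nz: "v \<noteq> 0" "tau v \<noteq> 0" using v pos[of v] by auto
      show "v \<in> {w. pt w \<in> A}" if "tau (tau v) \<in> {w. pt w \<in> A}"
        using basin_pull[OF nz] that by blast
      show "v \<in> {w. pt w \<in> A}" if "tau (tau v) < M"
        using basin_pull[OF nz pt_far_in_basin] that R by (auto simp: M_def)
    qed (simp add: M_def)
    then show ?thesis by simp
  qed
  obtain e where e: "e > 0" "\<And>w. \<bar>w\<bar> < e \<Longrightarrow> T (pt w) \<in> A" using pt_near_0_in_preimage by blast
  have right: "T (pt w) \<in> A" if "q < w" "w < 0" for w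
  proof (cases "\<bar>w\<bar> < e")
    case False
    have "w \<in> {w. T (pt w) \<in> A}"
    proof (rule increasing_orbit_enters[of w "- e / 2" "\<lambda>w. tau (tau w)"])
      show "continuous_on {w..- e / 2} (\<lambda>w. tau (tau w))" using e(1) by (intro cont) auto
      fix v assume "v \<in> {w..- e / 2}"
      then have v: "q < v" "v < 0" using that e(1) by auto
      show "v < tau (tau v)" using key[OF v] \<open>tau (tau q) = q\<close> by force
      have nz: "v \<noteq> 0" "tau v \<noteq> 0" using v pos[of v] by auto
      show "v \<in> {w. T (pt w) \<in> A}" if "tau (tau v) \<in> {w. T (pt w) \<in> A}"
        using preimage_pull[OF nz] that by simp
      show "v \<in> {w. T (pt w) \<in> A}" if "- e / 2 < tau (tau v)"
        using preimage_pull[OF nz e(2)] that neg[OF pos[OF v(2)]] by auto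
    qed (use False that e(1) in auto)
    then show ?thesis by simp
  qed (rule e)
  show ?thesis
  proof (rule not_sierpinski_carpet_at_cycle[of q "q - 1" "q / 2"])
    show "pt t \<in> A" if "t \<in> closed_segment q (q - 1)" "t \<noteq> q" for t
      using that by (intro left) (auto simp: closed_segment_eq_real_ivl split: if_splits)
    show "T (pt t) \<in> A" if "t \<in> closed_segment q (q / 2)" "t \<noteq> q" for t
      using that \<open>q < 0\<close> by (intro right) (auto simp: closed_segment_eq_real_ivl split: if_splits)
  qed (use \<open>q < 0\<close> \<open>tau (tau q) = q\<close> pos[of q] in auto)
qed

end

section \<open>The parameter zero\<close>

text \<open>
  A power has nonnegative Taylor coefficients at \<open>a \<ge> 0\<close>, so its increment is largest in the positive
  direction.
\<close>

lemma cmod_power_increment: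
  fixes u :: complex and a :: real
  assumes "0 \<le> a"
  shows "cmod ((of_real a + u) ^ n - of_real a ^ n) \<le> (a + cmod u) ^ n - a ^ n"
proof (induction n)
  case (Suc n)
  have eq: "(of_real a + u) ^ Suc n - of_real a ^ Suc n
      = (of_real a + u) * ((of_real a + u) ^ n - of_real a ^ n) + u * of_real a ^ n"
    by (simp add: algebra_simps)
  have "cmod (of_real a + u) \<le> a + cmod u" using norm_triangle_ineq[of "of_real a" u] assms by simp
  then have "cmod (of_real a + u) * cmod ((of_real a + u) ^ n - of_real a ^ n)
      \<le> (a + cmod u) * ((a + cmod u) ^ n - a ^ n)"
    using Suc assms by (intro mult_mono) auto
  then have "cmod ((of_real a + u) ^ Suc n - of_real a ^ Suc n)
      \<le> (a + cmod u) * ((a + cmod u) ^ n - a ^ n) + cmod u * a ^ n"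
    unfolding eq
    using norm_triangle_ineq[of "(of_real a + u) * ((of_real a + u) ^ n - of_real a ^ n)" "u * of_real a ^ n"] assms
    by (simp add: norm_mult norm_power)
  then show ?case by (simp add: algebra_simps)
qed simp

text \<open>
  At the parabolic point \<open>1\<close> the invariant discs are horocyclic: the polynomial maps the disc with centre
  \<open>a\<close> in \<open>[0, 1]\<close> and radius \<open>1 - a\<close> into the disc with centre \<open>g a\<close> and radius \<open>1 - g a\<close>. As the orbit of
  \<open>0\<close> increases to \<open>1\<close>, the iterates of the unit disc shrink to the point \<open>1\<close>.
\<close>

lemma not_sierpinski_carpet_zero:
  assumes d: "d \<ge> 2"
  shows "\<not> sierpinski_carpet (julia_set (U d 0))"
proof -
  define f where "f = affine_power d (1 / of_nat d)"
  define h where "h = (\<lambda>z::complex. (1 + 1 / of_nat d * (z - 1)) ^ d)"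
  define g where "g = (\<lambda>x::real. (1 + (x - 1) / d) ^ d)"
  have f_Fin: "f (Fin z) = Fin (h z)" for z by (simp add: f_def h_def)
  have h_real: "h (of_real x) = of_real (g x)" for x by (simp add: h_def g_def)
  have gsum: "g x - 1 = (x - 1) / d * (\<Sum>k<d. (1 + (x - 1) / d) ^ k)" for x
    by (simp add: g_def power_diff_1_eq)
  have up: "x < g x" if "0 \<le> x" "x \<noteq> 1" for x
  proof -
    have base: "0 \<le> 1 + (x - 1) / d" using that d by (simp add: field_simps)
    have "(x - 1) / d * d < (x - 1) / d * (\<Sum>k<d. (1 + (x - 1) / d) ^ k)"
    proof (cases "x < 1")
      case True
      have "(\<Sum>k<d. (1 + (x - 1) / d) ^ k) < (\<Sum>k<d. 1 ^ k)"
        using base True d by (intro sum_powers_strict_mono) (auto simp: divide_neg_pos)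
      then show ?thesis using True d by (intro mult_strict_left_mono_neg) (auto simp: divide_neg_pos)
    next
      case False
      then have "(\<Sum>k<d. 1 ^ k) < (\<Sum>k<d. (1 + (x - 1) / d) ^ k)"
        using that d by (intro sum_powers_strict_mono) auto
      then show ?thesis using False that d by (intro mult_strict_left_mono) auto
    qed
    then show ?thesis using gsum[of x] d by simp
  qed
  have contg: "continuous_on S g" for S unfolding g_def by (intro continuous_intros) (use d in auto)
  have contf: "continuous_on UNIV f" unfolding f_def using d by (intro continuous_on_affine_power) auto
  obtain R where R: "R > 0" "\<And>r. r \<ge> R \<Longrightarrow> f ` outer_disc r \<subseteq> outer_disc (2 * r)"
    using affine_power_outer_disc[of "1 / of_nat d" d] d unfolding f_def by auto
  have lim: "uniform_limit (outer_disc R) (\<lambda>n. f ^^ n) (\<lambda>_. Infty) sequentially"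
    by (rule uniform_limit_outer_disc[OF R])
  have right: "Fin (of_real x) \<in> basin f (outer_disc R)" if "1 < x" for x
  proof -
    define M where "M = max x (R + 1)"
    have "x \<in> {x. Fin (of_real x) \<in> basin f (outer_disc R)}"
    proof (rule increasing_orbit_enters[OF contg[of "{x..M}"]])
      fix v assume "v \<in> {x..M}"
      then have v: "1 < v" using that by simp
      show "v < g v" using up v by simp
      have fv: "f (Fin (of_real v)) = Fin (of_real (g v))" by (simp add: f_Fin h_real)
      show "v \<in> {x. Fin (of_real x) \<in> basin f (outer_disc R)}"
        if "g v \<in> {x. Fin (of_real x) \<in> basin f (outer_disc R)}"
        using basin_backward[of f "Fin (of_real v)" "outer_disc R"] that fv by simp
      show "v \<in> {x. Fin (of_real x) \<in> basin f (outer_disc R)}" if "M < g v"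
      proof -
        have "R < g v" using that by (simp add: M_def)
        then have "Fin (of_real (g v)) \<in> outer_disc R" unfolding Fin_in_outer_disc norm_of_real by simp
        then have "f (Fin (of_real v)) \<in> basin f (outer_disc R)" unfolding fv by (rule subsetD[OF subset_basin])
        then have "Fin (of_real v) \<in> basin f (outer_disc R)" by (rule basin_backward)
        then show ?thesis by simp
      qed
    qed (simp add: M_def)
    then show ?thesis by simp
  qed
  have disc: "0 \<le> g a \<and> g a \<le> 1 \<and> cmod (h z - of_real (g a)) \<le> 1 - g a"
    if "0 \<le> a" "a \<le> 1" "cmod (z - of_real a) \<le> 1 - a" for a z
  proof -
    define b u where "b = 1 + (a - 1) / d" and "u = (z - of_real a) / of_nat d"
    have b: "0 \<le> b" "b \<le> 1" using that d by (simp_all add: b_def field_simps)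
    have "1 + 1 / of_nat d * (z - 1) = of_real b + u" using d by (simp add: b_def u_def field_simps)
    then have "h z - of_real (g a) = (of_real b + u) ^ d - of_real b ^ d"
      by (simp add: h_def g_def b_def add.assoc)
    then have "cmod (h z - of_real (g a)) \<le> (b + cmod u) ^ d - b ^ d"
      using cmod_power_increment[OF b(1), of u d] by simp
    also have "cmod u \<le> (1 - a) / d" using that(3) d by (simp add: u_def norm_divide divide_right_mono)
    then have "b + cmod u \<le> 1" using d by (simp add: b_def field_simps)
    then have "(b + cmod u) ^ d \<le> 1" using b by (intro power_le_one) auto
    finally have "cmod (h z - of_real (g a)) \<le> 1 - b ^ d" by simp
    then show ?thesis using b by (simp add: g_def b_def[symmetric] power_le_one)
  qed
  have orbit: "0 \<le> (g ^^ n) 0 \<and> (g ^^ n) 0 \<le> 1 \<and> cmod ((h ^^ n) z - of_real ((g ^^ n) 0)) \<le> 1 - (g ^^ n) 0"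
    if "cmod z \<le> 1" for n z
  proof (induction n)
    case (Suc n)
    then show ?case using disc[of "(g ^^ n) 0" "(h ^^ n) z"] by simp
  qed (use that in simp)
  have conv: "\<exists>n. \<forall>m\<ge>n. 1 - e < (g ^^ m) 0" if "0 < e" "e < 1" for e
  proof -
    have "0 \<in> {x. \<exists>n. 1 - e < (g ^^ n) x}"
    proof (rule increasing_orbit_enters[OF contg[of "{0..1 - e}"]])
      fix v assume v: "v \<in> {0..1 - e}"
      show "v < g v" using up v that by simp
      show "v \<in> {x. \<exists>n. 1 - e < (g ^^ n) x}" if "g v \<in> {x. \<exists>n. 1 - e < (g ^^ n) x}"
      proof -
        from that obtain n where "1 - e < (g ^^ n) (g v)" by blast
        then have "1 - e < (g ^^ Suc n) v" by (simp only: funpow_Suc_right o_apply)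
        then show ?thesis by blast
      qed
      show "v \<in> {x. \<exists>n. 1 - e < (g ^^ n) x}" if "1 - e < g v"
      proof -
        have "1 - e < (g ^^ 1) v" using that by simp
        then show ?thesis by blast
      qed
    qed (use that in auto)
    then obtain n where n: "1 - e < (g ^^ n) 0" by blast
    have inc: "(g ^^ m) 0 \<le> (g ^^ Suc m) 0" for m
    proof (cases "(g ^^ m) 0 = 1")
      case True
      then show ?thesis by (simp add: g_def)
    next
      case False
      then show ?thesis using up[of "(g ^^ m) 0"] orbit[of 0 m] by simp
    qed
    have "(g ^^ n) 0 \<le> (g ^^ m) 0" if "n \<le> m" for m
      using lift_Suc_mono_le[of "\<lambda>m. (g ^^ m) 0", OF inc that] .
    then show ?thesis using n less_le_trans by blast
  qed
  have f_iter: "(f ^^ n) (Fin z) = Fin ((h ^^ n) z)" for n z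
    by (induction n) (simp_all add: f_Fin)
  have lim1: "uniform_limit (Fin ` ball 0 1) (\<lambda>n. f ^^ n) (\<lambda>_. Fin 1) sequentially"
    unfolding uniform_limit_iff
  proof safe
    fix e :: real assume "e > 0"
    then have "eventually (\<lambda>y. y \<in> ball (Fin 1) e) (nhds (Fin 1))" by (intro eventually_nhds_in_open) auto
    then have "eventually (\<lambda>z. dist (Fin z) (Fin 1) < e) (nhds 1)"
      unfolding eventually_nhds_Fin by (simp add: dist_commute)
    then obtain \<delta> where \<delta>: "\<delta> > 0" "\<And>z. dist z 1 < \<delta> \<Longrightarrow> dist (Fin z) (Fin 1) < e"
      unfolding eventually_nhds_metric by blast
    have "0 < min (\<delta> / 2) (1 / 2)" "min (\<delta> / 2) (1 / 2) < (1 :: real)" using \<delta>(1) by auto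
    from conv[OF this]
    obtain n where n: "\<And>m. n \<le> m \<Longrightarrow> 1 - min (\<delta> / 2) (1 / 2) < (g ^^ m) 0" by blast
    show "\<forall>\<^sub>F n in sequentially. \<forall>x\<in>Fin ` ball 0 1. dist ((f ^^ n) x) (Fin 1) < e"
      unfolding eventually_sequentially
    proof (intro exI allI impI ballI)
      fix m x assume "n \<le> m" and "x \<in> Fin ` ball 0 1"
      then obtain z where z: "x = Fin z" "cmod z \<le> 1" by auto
      have "cmod ((h ^^ m) z - 1) \<le> cmod ((h ^^ m) z - of_real ((g ^^ m) 0)) + cmod (of_real ((g ^^ m) 0) - 1)"
        using norm_triangle_ineq[of "(h ^^ m) z - of_real ((g ^^ m) 0)" "of_real ((g ^^ m) 0) - 1"] by simp
      also have "cmod (of_real ((g ^^ m) 0) - 1) = 1 - (g ^^ m) 0"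
        using orbit[OF z(2), of m] norm_of_real[of "(g ^^ m) 0 - 1", where 'a = complex] by simp
      finally have "dist ((h ^^ m) z) 1 < \<delta>"
        using orbit[OF z(2), of m] n[OF \<open>n \<le> m\<close>] min.cobounded1[of "\<delta> / 2" "1 / 2"]
        unfolding dist_norm by linarith
      then show "dist ((f ^^ m) x) (Fin 1) < e" using \<delta>(2) by (simp add: z f_iter)
    qed
  qed
  have left: "Fin (of_real x) \<in> fatou_set f - basin f (outer_disc R)" if "0 \<le> x" "x < 1" for x
  proof
    have x: "Fin (of_real x) \<in> Fin ` ball 0 1" using that by simp
    then show "Fin (of_real x) \<in> fatou_set f"
      using normal_family_on_range[OF lim1] open_Fin_image[OF open_ball] unfolding fatou_set_def by blast
    show "Fin (of_real x) \<notin> basin f (outer_disc R)"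
    proof
      assume "Fin (of_real x) \<in> basin f (outer_disc R)"
      from LIMSEQ_unique[OF basin_tendsto[OF lim this] tendsto_uniform_limitI[OF lim1 x]] show False by simp
    qed
  qed
  have "\<not> sierpinski_carpet (julia_set f)"
  proof (rule not_sierpinski_carpet_julia_set[OF contf open_outer_disc Infty_in_outer_disc lim,
        where x = 1 and ?c1.0 = 2 and ?c2.0 = 0])
    show "Fin (of_real 1) \<notin> basin f (outer_disc R)"
      by (rule fixed_point_not_in_basin[OF lim]) (simp_all add: f_Fin h_def)
    show "Fin (of_real t) \<in> basin f (outer_disc R)" if "t \<in> closed_segment 1 2" "t \<noteq> 1" for t
      using that by (intro right) (auto simp: closed_segment_eq_real_ivl)
    show "Fin (of_real t) \<in> fatou_set f - basin f (outer_disc R)" if "t \<in> closed_segment 1 0" "t \<noteq> 1" for t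
      using that by (intro left) (auto simp: closed_segment_eq_real_ivl)
  qed auto
  then show ?thesis using U_0_eq_affine_power[of d] d by (simp add: f_def)
qed

section \<open>All real parameters\<close>

theorem theorem1p2:
  fixes d :: nat and l :: real
  assumes "d \<ge> 2"
  shows "\<not> sierpinski_carpet (julia_set (U d (complex_of_real l)))"
proof (cases "l = 0")
  case True
  then show ?thesis using not_sierpinski_carpet_zero[OF assms] by simp
next
  case False
  obtain R where R: "R > 0" "\<And>r. r \<ge> R \<Longrightarrow>
      (renorm d (of_real l) \<circ> renorm d (of_real l)) ` outer_disc r \<subseteq> outer_disc (2 * r)"
    using renorm_renorm_outer_disc[of "of_real l" d] assms False by auto
  interpret real_parameter d l R
    using assms False R by unfold_locales auto
  have "\<not> sierpinski_carpet (julia_set F)"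
    using not_sierpinski_carpet_positive not_sierpinski_carpet_negative_even not_sierpinski_carpet_negative_odd False
    by (cases "l > 0") auto
  then show ?thesis using U_eq_renorm_renorm[of "of_real l" d] assms False by simp
qed

end
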